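(* Let $p\in M^2_{\mathrm{reg}}$ be a point in a smooth regular surface in $\mathbb{R}^5$, let $u\in T_pM^2_{\mathrm{reg}}$ be a unit tangent vector and let $\pi_u$ be the orthogonal projection along $u$ to $\mathbb{R}^4$, so that $\pi_u(p)$ is a corank 1 singular point of the surface $M^2_{\mathrm{sing}}=\pi_u(M^2_{\mathrm{reg}})\subset\mathbb{R}^4$. Suppose $M^2_{\mathrm{reg}}$ is a generic surface. Then: (i) $p\in\mathcal{M}_2^h$ if and only if $\pi_u(p)$ is a hyperbolic point; (ii) $p\in\mathcal{M}_2^e$ if and only if $\pi_u(p)$ is an elliptic point; (iii) $p\in\mathcal{M}_2^p$ if and only if $\pi_u(p)$ is a parabolic point. Moreover, $v$ is an $A_k$-asymptotic direction at $p$ if and only if $v$ is asymptotic for $\pi_u(p)$. That is, the two (resp. one) $A_k$-asymptotic directions for a point $p\in\mathcal{M}_2^h$ (resp. $p\in\mathcal{M}_2^p$) are exactly the only two (resp. one) asymptotic directions at $\pi_u(p)$.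
   Context: Regular surface in $\mathbb{R}^5$. $II_p$ is the second fundamental form with values in the 3-dimensional normal space $N_pM^2_{\mathrm{reg}}$ (origin $p$); for an orthonormal basis $\{e_1,e_2\}$ of $T_pM^2_{\mathrm{reg}}$, $\alpha_p$ is the $3\times3$ matrix whose columns are the coordinates of $II_p(e_1,e_1),II_p(e_1,e_2),II_p(e_2,e_2)$ in an orthonormal frame of $N_pM^2_{\mathrm{reg}}$; $\mathcal{M}_i$ is the set of points with $\operatorname{rank}\alpha_p=i$. The curvature ellipse is $\Delta_e^5=\{II_p(w,w):|w|=1\}$. A point $p\in\mathcal{M}_2$ is in $\mathcal{M}_2^h$, $\mathcal{M}_2^e$, $\mathcal{M}_2^p$ according to whether the origin $p$ of $N_pM^2_{\mathrm{reg}}$ lies outside, inside, or on $\Delta_e^5$; semiumbilic points (where the ellipse degenerates to a segment not containing $p$) are considered as points of type $\mathcal{M}_2^h$. For a unit $\nu\in N_pM^2_{\mathrm{reg}}$, $h_\nu(x)=\langle x,\nu\rangle$ on $M^2_{\mathrm{reg}}$. $\nu$ is a degenerate direction if $h_\nu$ has a singularity $A_2$ or worse at $p$, and binormal if it is $A_3$ or worse. A unit $v\in T_pM^2_{\mathrm{reg}}$ is a contact direction associated to a degenerate direction $\nu$ if $v\in\ker\operatorname{Hess}(h_\nu)(p)$, and $v$ is $A_k$-asymptotic if it is a contact direction associated to a binormal direction $\nu$ such that $h_\nu$ has an $A_k$-singularity, $k\geq3$. Generic: for a generically immersed surface, $M^2_{\mathrm{reg}}=\mathcal{M}_3\cup\mathcal{M}_2$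 with $\mathcal{M}_2$ a regular curve, and the families of height functions and of orthogonal projections to 4-spaces have only their generic singularities. In particular: $p\in\mathcal{M}_3$ if and only if $h_\nu$ has only $A_k$-singularities for every normal $\nu$ at $p$; $p\in\mathcal{M}_2^h\cup\mathcal{M}_2^e$ (resp. $\mathcal{M}_2^p$) if and only if some $h_\nu$ has a $D_4^\pm$ (resp. $D_5$) singularity at $p$; the singular projections along tangent directions have $\mathcal{A}_e$-codimension at most 4, i.e. are $\mathcal{A}$-equivalent (equivalent by smooth changes of coordinates in source and target) to $(x,xy,y^2,y^{2k+1})$, $k=1,\dots,4$; $(x,y^2,y^3,x^2y)$; $(x,y^2,y^3\pm x^2y,x^3y)$; or $(x,xy,xy^2\pm y^4,y^3)$. Singular surface in $\mathbb{R}^4$. $M^2_{\mathrm{sing}}$ is the image of $g=\pi_u|_{M^2_{\mathrm{reg}}}:\tilde M=M^2_{\mathrm{reg}}\to u^\perp\cong\mathbb{R}^4$, $\pi_u(x)=x-\langle x,u\rangle u$, of corank 1 at $q=p$. The normal space $N$ at $\pi_u(p)$ is the 3-dimensional orthogonal complement of the line $\operatorname{Im}dg_q$; $I(v,w)=\langle dg_q(v),dg_q(w)\rangle$ on $T_q\tilde M$; $II:T_q\tilde M\times T_q\tilde M\to N$ is the symmetric bilinear map given by the orthogonal projection to $N$ of the second partial derivatives of $g$; $II_\nu=\langle II,\nu\rangle$. The curvature parabola is $\Delta=\{II(w,w):I(w,w)=1\}$, and $\mathrm{Aff}$ is the smallest affine subspace containing it. $E$ is the plane through the origin of $N$ which is: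 parallel to $\mathrm{Aff}$ if $\Delta$ is a non-degenerate parabola; the plane through the origin containing $\mathrm{Aff}$ if $\Delta$ is a non-radial half-line or line; any plane through the origin containing $\mathrm{Aff}$ if $\Delta$ is a radial half-line, a radial line or a point (radial: contained in a line through the origin). A non-zero $v\in T_q\tilde M$ is asymptotic at $\pi_u(p)$ if there is a non-zero $\nu\in E$ with $II_\nu(v,w)=0$ for all $w\in T_q\tilde M$. The singular point is hyperbolic, elliptic, parabolic or an inflection point if it has 2, 0, 1 or infinitely many asymptotic directions (up to scaling), respectively. Directions in $T_q\tilde M$ and $T_pM^2_{\mathrm{reg}}$ are identified.
   Formalization: Assumes p in M_2 (at M_3 points (i)-(iii) fail together); "asymptotic for π_u(p) implies A_k-asymptotic" and the counts also assume that the cubic form of the D_4/D_5 height function is nonzero on contact directions of A_2 normals, since otherwise that implication fails. *)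

theory Defs
  imports "HOL-Analysis.Analysis"
begin

section \<open>Smooth maps and germs of diffeomorphisms\<close>

definition ddir :: "'a::real_normed_vector \<Rightarrow> ('a \<Rightarrow> 'b::real_normed_vector) \<Rightarrow> 'a \<Rightarrow> 'b" where
  "ddir v f = (\<lambda>x. frechet_derivative f (at x) v)"

definition D2 :: "('a::real_normed_vector \<Rightarrow> 'b::real_normed_vector) \<Rightarrow> 'a \<Rightarrow> 'a \<Rightarrow> 'a \<Rightarrow> 'b" where
  "D2 f x a b = ddir b (ddir a f) x"

definition D3 :: "('a::real_normed_vector \<Rightarrow> 'b::real_normed_vector) \<Rightarrow> 'a \<Rightarrow> 'a \<Rightarrow> 'a \<Rightarrow> 'a \<Rightarrow> 'b" where
  "D3 f x a b c = ddir c (ddir b (ddir a f)) x"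

text \<open>Only used on open sets, where all directional derivatives being of class \<open>C\<^sup>k\<close>
  is the same as the derivative being of class \<open>C\<^sup>k\<close> (finite dimension).\<close>

primrec Ck_on :: "nat \<Rightarrow> 'a::euclidean_space set \<Rightarrow> ('a \<Rightarrow> 'b::euclidean_space) \<Rightarrow> bool" where
  "Ck_on 0 U f \<longleftrightarrow> continuous_on U f"
| "Ck_on (Suc k) U f \<longleftrightarrow> (\<forall>x\<in>U. f differentiable (at x)) \<and> (\<forall>v. Ck_on k U (ddir v f))"

definition smooth_on :: "'a::euclidean_space set \<Rightarrow> ('a \<Rightarrow> 'b::euclidean_space) \<Rightarrow> bool" where
  "smooth_on U f \<longleftrightarrow> (\<forall>k. Ck_on k U f)"

text \<open>All germs below are germs at the origin.\<close>

definition germ_diffeo :: "('a::euclidean_space \<Rightarrow> 'a) \<Rightarrow> bool" where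
  "germ_diffeo \<Phi> \<longleftrightarrow> \<Phi> 0 = 0 \<and>
     (\<exists>U V \<Psi>. open U \<and> open V \<and> 0 \<in> U \<and> smooth_on U \<Phi> \<and> smooth_on V \<Psi> \<and> homeomorphism U V \<Phi> \<Psi>)"

definition right_equiv :: "(real^2 \<Rightarrow> real) \<Rightarrow> (real^2 \<Rightarrow> real) \<Rightarrow> bool" where
  "right_equiv f g \<longleftrightarrow> (\<exists>\<Phi>. germ_diffeo \<Phi> \<and> (\<forall>\<^sub>F x in nhds 0. f (\<Phi> x) = g x))"

definition A_equiv :: "(real^2 \<Rightarrow> real^4) \<Rightarrow> (real^2 \<Rightarrow> real^4) \<Rightarrow> bool" where
  "A_equiv f g \<longleftrightarrow>
     (\<exists>\<Phi> \<Theta>. germ_diffeo \<Phi> \<and> germ_diffeo \<Theta> \<and> (\<forall>\<^sub>F x in nhds 0. \<Theta> (f (\<Phi> x)) = g x))"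

section \<open>Singularities of functions of two variables\<close>

definition A_sing :: "nat \<Rightarrow> (real^2 \<Rightarrow> real) \<Rightarrow> bool" where
  "A_sing k f \<longleftrightarrow> (\<exists>\<epsilon>\<in>{1,-1}. \<exists>\<delta>\<in>{1,-1}.
     right_equiv (\<lambda>x. f x - f 0) (\<lambda>x. \<epsilon> * (x$1)^2 + \<delta> * (x$2)^(k+1)))"

text \<open>For \<open>D\<^sub>4\<close> the sign \<open>\<epsilon>\<close> distinguishes \<open>D\<^sub>4\<^sup>+\<close> and \<open>D\<^sub>4\<^sup>-\<close>.\<close>

definition D_sing :: "nat \<Rightarrow> (real^2 \<Rightarrow> real) \<Rightarrow> bool" where
  "D_sing k f \<longleftrightarrow> (\<exists>\<epsilon>\<in>{1,-1}.
     right_equiv (\<lambda>x. f x - f 0) (\<lambda>x. (x$1)^2 * x$2 + \<epsilon> * (x$2)^(k-1)))"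

definition A_or_worse :: "nat \<Rightarrow> (real^2 \<Rightarrow> real) \<Rightarrow> bool" where
  "A_or_worse k f \<longleftrightarrow>
     frechet_derivative f (at 0) = (\<lambda>_. 0) \<and> (\<forall>j\<in>{1..<k}. \<not> A_sing j f)"

section \<open>Surfaces and curves in Euclidean space\<close>

definition local_param :: "'b set \<Rightarrow> 'b \<Rightarrow> ('a::euclidean_space \<Rightarrow> 'b::euclidean_space) \<Rightarrow> bool" where
  "local_param S p \<phi> \<longleftrightarrow> \<phi> 0 = p \<and>
     (\<exists>U \<psi>. open U \<and> 0 \<in> U \<and> smooth_on U \<phi> \<and>
        (\<forall>x\<in>U. inj (frechet_derivative \<phi> (at x))) \<and>
        openin (top_of_set S) (\<phi> ` U) \<and> homeomorphism U (\<phi> ` U) \<phi> \<psi>)"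

definition regular_surface :: "(real^5) set \<Rightarrow> bool" where
  "regular_surface M \<longleftrightarrow> (\<forall>p\<in>M. \<exists>\<phi>::real^2 \<Rightarrow> real^5. local_param M p \<phi>)"

definition regular_curve :: "(real^5) set \<Rightarrow> bool" where
  "regular_curve C \<longleftrightarrow> (\<forall>p\<in>C. \<exists>\<gamma>::real \<Rightarrow> real^5. local_param C p \<gamma>)"

text \<open>The notions below are computed in a local parametrization sending \<open>0\<close> to \<open>p\<close>; none of
  them depends on which one is chosen. (For second derivatives this holds because
  they are projected orthogonally to the image of the first derivative; for Hessians of height
  functions because they are taken at a critical point; for the cubic form because it is used only
  where the Hessian vanishes.)\<close>

definition chart :: "(real^5) set \<Rightarrow> real^5 \<Rightarrow> real^2 \<Rightarrow> real^5" where
  "chart M p = (SOME \<phi>. local_param M p \<phi>)"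

definition tangent_space :: "(real^5) set \<Rightarrow> real^5 \<Rightarrow> (real^5) set" where
  "tangent_space M p = range (frechet_derivative (chart M p) (at 0))"

definition coord :: "(real^5) set \<Rightarrow> real^5 \<Rightarrow> real^5 \<Rightarrow> real^2" where
  "coord M p v = inv (frechet_derivative (chart M p) (at 0)) v"

definition normal_space :: "(real^5) set \<Rightarrow> real^5 \<Rightarrow> (real^5) set" where
  "normal_space M p = orthogonal_comp (tangent_space M p)"

definition orth_proj :: "(real^5) set \<Rightarrow> real^5 \<Rightarrow> real^5" where
  "orth_proj S x = (THE y. y \<in> S \<and> (\<forall>z\<in>S. orthogonal (x - y) z))"

definition II :: "(real^5) set \<Rightarrow> real^5 \<Rightarrow> real^5 \<Rightarrow> real^5 \<Rightarrow> real^5" where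
  "II M p v w = orth_proj (normal_space M p) (D2 (chart M p) 0 (coord M p v) (coord M p w))"

definition tangent_onb :: "(real^5) set \<Rightarrow> real^5 \<Rightarrow> real^5 \<Rightarrow> real^5 \<Rightarrow> bool" where
  "tangent_onb M p e1 e2 \<longleftrightarrow> e1 \<in> tangent_space M p \<and> e2 \<in> tangent_space M p \<and>
     norm e1 = 1 \<and> norm e2 = 1 \<and> orthogonal e1 e2"

definition normal_frame :: "(real^5) set \<Rightarrow> real^5 \<Rightarrow> (3 \<Rightarrow> real^5) \<Rightarrow> bool" where
  "normal_frame M p n \<longleftrightarrow> (\<forall>i. n i \<in> normal_space M p) \<and>
     (\<forall>i j. n i \<bullet> n j = (if i = j then 1 else 0))"

definition alpha :: "(real^5) set \<Rightarrow> real^5 \<Rightarrow> real^5 \<Rightarrow> real^5 \<Rightarrow> (3 \<Rightarrow> real^5) \<Rightarrow> real^3^3" where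
  "alpha M p e1 e2 n =
     (\<chi> i. vector [II M p e1 e1 \<bullet> n i, II M p e1 e2 \<bullet> n i, II M p e2 e2 \<bullet> n i])"

text \<open>The rank does not depend on the orthonormal bases.\<close>

definition rank_stratum :: "(real^5) set \<Rightarrow> nat \<Rightarrow> (real^5) set" where
  "rank_stratum M i = {p \<in> M. \<exists>e1 e2 n. tangent_onb M p e1 e2 \<and> normal_frame M p n \<and>
     rank (alpha M p e1 e2 n) = i}"

definition curvature_ellipse :: "(real^5) set \<Rightarrow> real^5 \<Rightarrow> (real^5) set" where
  "curvature_ellipse M p = {II M p w w | w. w \<in> tangent_space M p \<and> norm w = 1}"

text \<open>The origin of the normal space lies outside the ellipse if it is not in the (plane) region
  bounded by it, that is, in its convex hull. At a point of rank 2 whose ellipse is a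
  segment, the line of that segment misses the origin (otherwise the rank would be at most 1), so
  semiumbilic points are in \<open>M2h\<close>.\<close>

definition M2h :: "(real^5) set \<Rightarrow> (real^5) set" where
  "M2h M = {p \<in> rank_stratum M 2. 0 \<notin> convex hull curvature_ellipse M p}"

definition M2e :: "(real^5) set \<Rightarrow> (real^5) set" where
  "M2e M = {p \<in> rank_stratum M 2. 0 \<in> convex hull curvature_ellipse M p - curvature_ellipse M p}"

definition M2p :: "(real^5) set \<Rightarrow> (real^5) set" where
  "M2p M = {p \<in> rank_stratum M 2. 0 \<in> curvature_ellipse M p}"

section \<open>Height functions, contact directions and asymptotic directions\<close>

definition height :: "(real^5) set \<Rightarrow> real^5 \<Rightarrow> real^5 \<Rightarrow> real^2 \<Rightarrow> real" where
  "height M p \<nu> = (\<lambda>x. chart M p x \<bullet> \<nu>)"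

definition unit_normal :: "(real^5) set \<Rightarrow> real^5 \<Rightarrow> real^5 \<Rightarrow> bool" where
  "unit_normal M p \<nu> \<longleftrightarrow> \<nu> \<in> normal_space M p \<and> norm \<nu> = 1"

definition unit_tangent :: "(real^5) set \<Rightarrow> real^5 \<Rightarrow> real^5 \<Rightarrow> bool" where
  "unit_tangent M p v \<longleftrightarrow> v \<in> tangent_space M p \<and> norm v = 1"

definition degenerate_dir :: "(real^5) set \<Rightarrow> real^5 \<Rightarrow> real^5 \<Rightarrow> bool" where
  "degenerate_dir M p \<nu> \<longleftrightarrow> unit_normal M p \<nu> \<and> A_or_worse 2 (height M p \<nu>)"

definition binormal_dir :: "(real^5) set \<Rightarrow> real^5 \<Rightarrow> real^5 \<Rightarrow> bool" where
  "binormal_dir M p \<nu> \<longleftrightarrow> unit_normal M p \<nu> \<and> A_or_worse 3 (height M p \<nu>)"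

definition contact_dir :: "(real^5) set \<Rightarrow> real^5 \<Rightarrow> real^5 \<Rightarrow> real^5 \<Rightarrow> bool" where
  "contact_dir M p \<nu> v \<longleftrightarrow> degenerate_dir M p \<nu> \<and> unit_tangent M p v \<and>
     (\<forall>w\<in>tangent_space M p. D2 (height M p \<nu>) 0 (coord M p v) (coord M p w) = 0)"

definition A_asymptotic :: "nat \<Rightarrow> (real^5) set \<Rightarrow> real^5 \<Rightarrow> real^5 \<Rightarrow> bool" where
  "A_asymptotic k M p v \<longleftrightarrow> k \<ge> 3 \<and>
     (\<exists>\<nu>. binormal_dir M p \<nu> \<and> contact_dir M p \<nu> v \<and> A_sing k (height M p \<nu>))"

definition cubic_form :: "(real^5) set \<Rightarrow> real^5 \<Rightarrow> real^5 \<Rightarrow> real^5 \<Rightarrow> real" where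
  "cubic_form M p \<nu> v = D3 (height M p \<nu>) 0 (coord M p v) (coord M p v) (coord M p v)"

text \<open>At a point of rank 2 some height function \<open>h\<^sub>\<mu>\<close> has zero Hessian. If the
  cubic form of \<open>h\<^sub>\<mu>\<close> vanishes on the contact direction of an \<open>A\<^sub>2\<close> direction \<open>\<nu>\<close>, then every
  combination of \<open>\<nu>\<close> and \<open>\<mu>\<close> other than \<open>\<plusminus>\<mu>\<close> still gives an \<open>A\<^sub>2\<close> singularity. On a generic surface
  this coincidence can occur at isolated points of the rank 2 curve.\<close>

definition no_A2_contact_on_cubic :: "(real^5) set \<Rightarrow> real^5 \<Rightarrow> bool" where
  "no_A2_contact_on_cubic M p \<longleftrightarrow>
     (\<forall>\<nu> \<mu> v. contact_dir M p \<nu> v \<and> A_sing 2 (height M p \<nu>) \<and>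
        unit_normal M p \<mu> \<and> (\<exists>k\<ge>4. D_sing k (height M p \<mu>)) \<longrightarrow> cubic_form M p \<mu> v \<noteq> 0)"

section \<open>The singular surface obtained by projecting along a tangent direction\<close>

definition proj_along :: "real^5 \<Rightarrow> real^5 \<Rightarrow> real^5" where
  "proj_along u x = x - (x \<bullet> u) *\<^sub>R u"

definition sing_map :: "(real^5) set \<Rightarrow> real^5 \<Rightarrow> real^5 \<Rightarrow> real^2 \<Rightarrow> real^5" where
  "sing_map M p u = (\<lambda>x. proj_along u (chart M p x))"

text \<open>The target \<open>\<real>\<^sup>4\<close> is the hyperplane orthogonal to \<open>u\<close>, inside \<open>\<real>\<^sup>5\<close>.\<close>

definition sing_normal_space :: "(real^5) set \<Rightarrow> real^5 \<Rightarrow> real^5 \<Rightarrow> (real^5) set" where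
  "sing_normal_space M p u =
     orthogonal_comp {u} \<inter> orthogonal_comp (range (frechet_derivative (sing_map M p u) (at 0)))"

definition sing_I :: "(real^5) set \<Rightarrow> real^5 \<Rightarrow> real^5 \<Rightarrow> real^5 \<Rightarrow> real^5 \<Rightarrow> real" where
  "sing_I M p u v w = ddir (coord M p v) (sing_map M p u) 0 \<bullet> ddir (coord M p w) (sing_map M p u) 0"

definition sing_II :: "(real^5) set \<Rightarrow> real^5 \<Rightarrow> real^5 \<Rightarrow> real^5 \<Rightarrow> real^5 \<Rightarrow> real^5" where
  "sing_II M p u v w =
     orth_proj (sing_normal_space M p u) (D2 (sing_map M p u) 0 (coord M p v) (coord M p w))"

definition curvature_parabola :: "(real^5) set \<Rightarrow> real^5 \<Rightarrow> real^5 \<Rightarrow> (real^5) set" where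
  "curvature_parabola M p u =
     {sing_II M p u w w | w. w \<in> tangent_space M p \<and> sing_I M p u w w = 1}"

definition nondegenerate_parabola :: "(real^5) set \<Rightarrow> bool" where
  "nondegenerate_parabola S \<longleftrightarrow> (\<exists>a b c. b \<noteq> c \<and> independent {b, c} \<and>
     S = range (\<lambda>t::real. a + t *\<^sub>R b + t\<^sup>2 *\<^sub>R c))"

definition is_half_line :: "(real^5) set \<Rightarrow> bool" where
  "is_half_line S \<longleftrightarrow> (\<exists>a d. d \<noteq> 0 \<and> S = {a + t *\<^sub>R d | t::real. t \<ge> 0})"

definition is_line :: "(real^5) set \<Rightarrow> bool" where
  "is_line S \<longleftrightarrow> (\<exists>a d. d \<noteq> 0 \<and> S = range (\<lambda>t::real. a + t *\<^sub>R d))"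

definition is_point :: "(real^5) set \<Rightarrow> bool" where
  "is_point S \<longleftrightarrow> (\<exists>a. S = {a})"

text \<open>In the second case the plane is unique exactly when the line or half-line is non-radial;
  otherwise any plane containing the affine hull is admitted.\<close>

definition asymptotic_plane :: "(real^5) set \<Rightarrow> real^5 \<Rightarrow> real^5 \<Rightarrow> (real^5) set \<Rightarrow> bool" where
  "asymptotic_plane M p u E \<longleftrightarrow>
     subspace E \<and> dim E = 2 \<and> E \<subseteq> sing_normal_space M p u \<and>
     (let \<Delta> = curvature_parabola M p u in
       (nondegenerate_parabola \<Delta> \<longrightarrow> affine_parallel (affine hull \<Delta>) E) \<and>
       (is_half_line \<Delta> \<or> is_line \<Delta> \<or> is_point \<Delta> \<longrightarrow> affine hull \<Delta> \<subseteq> E))"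

definition sing_asymptotic :: "(real^5) set \<Rightarrow> real^5 \<Rightarrow> real^5 \<Rightarrow> real^5 \<Rightarrow> bool" where
  "sing_asymptotic M p u v \<longleftrightarrow> v \<in> tangent_space M p \<and> v \<noteq> 0 \<and>
     (\<exists>E \<nu>. asymptotic_plane M p u E \<and> \<nu> \<in> E \<and> \<nu> \<noteq> 0 \<and>
        (\<forall>w\<in>tangent_space M p. sing_II M p u v w \<bullet> \<nu> = 0))"

text \<open>Directions up to scaling are represented by the lines they span.\<close>

definition directions :: "(real^5 \<Rightarrow> bool) \<Rightarrow> (real^5) set set" where
  "directions P = {span {v} | v. P v}"

definition hyperbolic_point :: "(real^5) set \<Rightarrow> real^5 \<Rightarrow> real^5 \<Rightarrow> bool" where
  "hyperbolic_point M p u \<longleftrightarrow> card (directions (sing_asymptotic M p u)) = 2"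

definition elliptic_point :: "(real^5) set \<Rightarrow> real^5 \<Rightarrow> real^5 \<Rightarrow> bool" where
  "elliptic_point M p u \<longleftrightarrow> directions (sing_asymptotic M p u) = {}"

definition parabolic_point :: "(real^5) set \<Rightarrow> real^5 \<Rightarrow> real^5 \<Rightarrow> bool" where
  "parabolic_point M p u \<longleftrightarrow> card (directions (sing_asymptotic M p u)) = 1"

section \<open>Generic surfaces\<close>

definition generic_projection_forms :: "(real^2 \<Rightarrow> real^4) set" where
  "generic_projection_forms =
     {(\<lambda>z. vector [z$1, z$1 * z$2, (z$2)^2, (z$2)^(2*k+1)]) | k. k \<in> {1..4}} \<union>
     {\<lambda>z. vector [z$1, (z$2)^2, (z$2)^3, (z$1)^2 * z$2]} \<union>
     {(\<lambda>z. vector [z$1, (z$2)^2, (z$2)^3 + \<epsilon> * (z$1)^2 * z$2, (z$1)^3 * z$2]) | \<epsilon>. \<epsilon> \<in> {1,-1}} \<union>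
     {(\<lambda>z. vector [z$1, z$1 * z$2, z$1 * (z$2)^2 + \<epsilon> * (z$2)^4, (z$2)^3]) | \<epsilon>. \<epsilon> \<in> {1,-1}}"

text \<open>\<open>L\<close> identifies the hyperplane orthogonal to \<open>u\<close> isometrically with \<open>\<real>\<^sup>4\<close>.\<close>

definition generic_projection :: "(real^5) set \<Rightarrow> real^5 \<Rightarrow> real^5 \<Rightarrow> bool" where
  "generic_projection M p u \<longleftrightarrow>
     (\<exists>L::real^5 \<Rightarrow> real^4. linear L \<and> (\<forall>x. orthogonal x u \<longrightarrow> norm (L x) = norm x) \<and>
        (\<exists>nf\<in>generic_projection_forms. A_equiv (\<lambda>x. L (sing_map M p u x - sing_map M p u 0)) nf))"

text \<open>\<open>A\<^sub>1\<close>, ..., \<open>A\<^sub>5\<close>, \<open>D\<^sub>4\<close>, \<open>D\<^sub>5\<close> are the singularities of functions of two variables that occur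
  in generic families with 4 parameters, here the normal directions in the sphere of \<open>\<real>\<^sup>5\<close>.\<close>

definition generic_surface :: "(real^5) set \<Rightarrow> bool" where
  "generic_surface M \<longleftrightarrow>
     M = rank_stratum M 3 \<union> rank_stratum M 2 \<and>
     regular_curve (rank_stratum M 2) \<and>
     (\<forall>p\<in>M. \<forall>\<nu>. unit_normal M p \<nu> \<longrightarrow>
        (\<exists>k\<in>{1..5}. A_sing k (height M p \<nu>)) \<or> D_sing 4 (height M p \<nu>) \<or> D_sing 5 (height M p \<nu>)) \<and>
     (\<forall>p\<in>M. p \<in> rank_stratum M 3 \<longleftrightarrow>
        (\<forall>\<nu>. unit_normal M p \<nu> \<longrightarrow> (\<exists>k\<ge>1. A_sing k (height M p \<nu>)))) \<and>
     (\<forall>p\<in>M. p \<in> M2h M \<union> M2e M \<longleftrightarrow> (\<exists>\<nu>. unit_normal M p \<nu> \<and> D_sing 4 (height M p \<nu>))) \<and>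
     (\<forall>p\<in>M. p \<in> M2p M \<longleftrightarrow> (\<exists>\<nu>. unit_normal M p \<nu> \<and> D_sing 5 (height M p \<nu>))) \<and>
     (\<forall>p\<in>M. \<forall>u. unit_tangent M p u \<longrightarrow> generic_projection M p u)"

end

theory Submission
  imports Defs
begin

text \<open>
  Let \<open>P\<close> be the span of the values of the second fundamental form at \<open>p\<close>; at a point of rank 2 it is
  a plane in the normal space. Projecting along the tangent vector \<open>u\<close> subtracts from the second
  derivatives only a multiple of \<open>u\<close>, so the surface and its projection have the same normal space
  and the same second fundamental form. Unit vectors for the degenerate first fundamental form are
  \<open>t u \<plusminus> u'\<close> with \<open>u'\<close> orthogonal to \<open>u\<close>, hence the curvature parabola is
  \<open>{II(u',u') + 2t II(u,u') + t\<^sup>2 II(u,u)}\<close>. It lies in \<open>P\<close> and affinely or linearly spans it, and the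
  asymptotic plane is \<open>P\<close> in every case (\<open>asymptotic_plane_iff\<close>). Thus \<open>v\<close> is asymptotic for the
  projection exactly if \<open>II(v,_) \<bullet> \<nu> = 0\<close> for some nonzero \<open>\<nu> \<in> P\<close>, a condition on \<open>M\<close> alone.

  In an orthonormal tangent basis put \<open>A = II(e1,e1)\<close>, \<open>B = II(e1,e2)\<close>, \<open>C = II(e2,e2)\<close>. As these
  span a plane, they satisfy one linear relation \<open>\<alpha> A + 2\<beta> B + \<gamma> C = 0\<close> up to a factor. By Cramer's
  rule \<open>\<alpha>, \<beta>, \<gamma>\<close> are the brackets of \<open>A, B, C\<close> in \<open>P\<close>, and \<open>x e1 + y e2\<close> is asymptotic exactly if
  \<open>\<gamma> x\<^sup>2 - 2\<beta> x y + \<alpha> y\<^sup>2 = 0\<close> (\<open>plane_relation\<close>). So there are 2, 1 or 0 asymptotic directions as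
  \<open>\<beta>\<^sup>2 - \<alpha>\<gamma>\<close> is positive, zero or negative. On the other hand, the convex hull of the
  ellipse consists of the vectors \<open>a A + 2b B + c C\<close> with a positive semidefinite symmetric matrix
  \<open>(a, b; b, c)\<close> of trace 1, and the ellipse itself of those where this matrix has rank 1. So the same
  sign decides whether the origin is outside, on or inside the ellipse (\<open>zero_in_ellipse_hull\<close>),
  which gives the correspondence of types (\<open>rank_two_trichotomy\<close>).

  For the asymptotic directions of \<open>M\<close>, the Hessian of the height function of \<open>\<nu>\<close> is the form
  \<open>II \<bullet> \<nu>\<close>. The properties of \<open>A\<^sub>k\<close> and \<open>D\<^sub>k\<close> that matter are read off along
  straight lines: a line \<open>t v\<close> corresponds under the diffeomorphism to a curve with nonzero velocity,
  and one compares the leading Taylor term of the function with that of the normal form. This shows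
  that the Hessian is nonzero for \<open>A\<^sub>k\<close>, nondegenerate for \<open>A\<^sub>1\<close> and zero for \<open>D\<^sub>k\<close>, and that for
  \<open>A\<^sub>2\<close> the cubic form is nonzero on the kernel (\<open>A2_cubic_nonzero\<close>). If \<open>v\<close> is \<open>A\<^sub>k\<close>-asymptotic
  for \<open>\<nu>\<close>, then \<open>\<nu>\<close> has a nonzero component in \<open>P\<close>, so \<open>v\<close> is asymptotic for the projection.
  Conversely let \<open>II(v,_) \<bullet> \<nu> = 0\<close> with \<open>\<nu> \<in> P\<close>. By genericity \<open>\<nu>\<close> gives some \<open>A\<^sub>k\<close>, \<open>k \<ge> 2\<close>. If
  \<open>k = 2\<close>, let \<open>\<mu>\<close> be the normal of \<open>P\<close>, whose height function has zero Hessian. Adding a multiple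
  of \<open>\<mu>\<close> to \<open>\<nu>\<close> keeps the Hessian, and as the cubic form of \<open>\<mu>\<close> is nonzero on \<open>v\<close> by
  \<open>no_A2_contact_on_cubic\<close>, a suitable multiple makes the cubic form vanish on \<open>v\<close>; the new direction then has \<open>k \<ge> 3\<close>.
\<close>

section \<open>Directional derivatives of smooth maps\<close>

lemma smooth_on_differentiable: "smooth_on U f \<Longrightarrow> x \<in> U \<Longrightarrow> f differentiable (at x)"
  unfolding smooth_on_def by (metis Ck_on.simps(2))

lemma smooth_on_ddir: "smooth_on U f \<Longrightarrow> smooth_on U (ddir v f)"
  unfolding smooth_on_def by (metis Ck_on.simps(2))

lemma smooth_on_continuous: "smooth_on U f \<Longrightarrow> continuous_on U f"
  unfolding smooth_on_def by (metis Ck_on.simps(1))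

lemma smooth_on_has_derivative:
  "smooth_on U f \<Longrightarrow> x \<in> U \<Longrightarrow> (f has_derivative (\<lambda>v. ddir v f x)) (at x)"
  using smooth_on_differentiable[of U f x] frechet_derivative_works[of f "at x"]
  unfolding ddir_def by simp

lemma linear_ddir: "smooth_on U f \<Longrightarrow> x \<in> U \<Longrightarrow> linear (\<lambda>v. ddir v f x)"
  using smooth_on_has_derivative has_derivative_linear by blast

lemma ddir_eqI: "(f has_derivative f') (at x) \<Longrightarrow> ddir v f x = f' v"
  unfolding ddir_def using frechet_derivative_at by metis

text \<open>
  Openness of \<open>U\<close> makes a derivative at a point of \<open>U\<close> depend only on the values in \<open>U\<close>.
\<close>

lemma ddir_cong:
  assumes "open U" "x \<in> U" "\<And>y. y \<in> U \<Longrightarrow> f y = g y"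
  shows "ddir v f x = ddir v g x"
proof -
  have "(f has_derivative D) (at x) \<longleftrightarrow> (g has_derivative D) (at x)" for D
    using has_derivative_transform_within_open[OF _ assms(1,2)] assms(3) by metis
  then show ?thesis by (simp add: ddir_def frechet_derivative_def)
qed

lemma Ck_on_cong:
  assumes "open U" "\<And>y. y \<in> U \<Longrightarrow> f y = g y"
  shows "Ck_on k U f \<longleftrightarrow> Ck_on k U g"
  using assms
proof (induction k arbitrary: f g)
  case 0
  then show ?case using continuous_on_cong by (metis Ck_on.simps(1))
next
  case (Suc k)
  have "f differentiable (at x) \<longleftrightarrow> g differentiable (at x)" if "x \<in> U" for x
    unfolding differentiable_def
    using has_derivative_transform_within_open[OF _ Suc.prems(1) that] Suc.prems(2) by metis
  moreover have "Ck_on k U (ddir v f) \<longleftrightarrow> Ck_on k U (ddir v g)" for v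
    by (rule Suc.IH[OF Suc.prems(1)], rule ddir_cong[OF Suc.prems(1)]) (simp_all add: Suc.prems(2))
  ultimately show ?case by simp
qed

text \<open>
  Postcomposition with a linear map covers both uses below: taking the component along a normal
  vector (height functions) and projecting along a tangent vector (the singular surface).
\<close>

lemma ddir_linear_image:
  assumes "linear L" "smooth_on U f" "x \<in> U"
  shows "ddir v (\<lambda>x. L (f x)) x = L (ddir v f x)"
  by (rule ddir_eqI) (rule bounded_linear.has_derivative[OF _ smooth_on_has_derivative[OF assms(2,3)]],
      use assms(1) in \<open>simp add: linear_conv_bounded_linear\<close>)

lemma smooth_on_linear_image:
  assumes "linear L" "open U" "smooth_on U f"
  shows "smooth_on U (\<lambda>x. L (f x))"
proof -
  have bl: "bounded_linear L" using assms(1) by (simp add: linear_conv_bounded_linear)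
  have "Ck_on k U (\<lambda>x. L (f x))" for k
    using assms(3)
  proof (induction k arbitrary: f)
    case 0
    then show ?case using bounded_linear.continuous_on[OF bl smooth_on_continuous] by simp
  next
    case (Suc k)
    have "(\<lambda>x. L (f x)) differentiable (at x)" if "x \<in> U" for x
      unfolding differentiable_def
      using bounded_linear.has_derivative[OF bl smooth_on_has_derivative[OF Suc.prems that]] by blast
    moreover have "Ck_on k U (ddir v (\<lambda>x. L (f x)))" for v
    proof -
      have "Ck_on k U (\<lambda>x. L (ddir v f x))" using Suc.IH smooth_on_ddir[OF Suc.prems] by blast
      then show ?thesis
        using Ck_on_cong[of U "ddir v (\<lambda>x. L (f x))" "\<lambda>x. L (ddir v f x)"] assms(2)
          ddir_linear_image[OF assms(1) Suc.prems] by blast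
    qed
    ultimately show ?case by simp
  qed
  then show ?thesis by (simp add: smooth_on_def)
qed

lemma D2_linear_image:
  assumes "linear L" "open U" "smooth_on U f" "x \<in> U"
  shows "D2 (\<lambda>x. L (f x)) x a b = L (D2 f x a b)"
  unfolding D2_def
  using ddir_cong[OF assms(2,4) ddir_linear_image[OF assms(1,3)], where v = b and v1 = "\<lambda>_. a"]
    ddir_linear_image[OF assms(1) smooth_on_ddir[OF assms(3)] assms(4)]
  by simp

lemma D3_linear_image:
  assumes "linear L" "open U" "smooth_on U f" "x \<in> U"
  shows "D3 (\<lambda>x. L (f x)) x a b c = L (D3 f x a b c)"
proof -
  have 1: "ddir b (ddir a (\<lambda>x. L (f x))) y = L (ddir b (ddir a f) y)" if "y \<in> U" for y
    using D2_linear_image[OF assms(1-3) that, of a b] by (simp add: D2_def)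
  show ?thesis
    unfolding D3_def
    using ddir_cong[OF assms(2,4) 1, where v = c]
      ddir_linear_image[OF assms(1) smooth_on_ddir[OF smooth_on_ddir[OF assms(3)]] assms(4)]
    by simp
qed

lemma smooth_on_line_DERIV:
  fixes f :: "'a::euclidean_space \<Rightarrow> real"
  assumes "smooth_on U f" "x + t *\<^sub>R v \<in> U"
  shows "((\<lambda>t. f (x + t *\<^sub>R v)) has_real_derivative ddir v f (x + t *\<^sub>R v)) (at t)"
proof -
  let ?D = "\<lambda>w. ddir w f (x + t *\<^sub>R v)"
  have "((\<lambda>t. f (x + t *\<^sub>R v)) has_derivative (\<lambda>h. ?D (h *\<^sub>R v))) (at t)"
    by (rule has_derivative_compose[where f = "\<lambda>t. x + t *\<^sub>R v" and g = f])
      (auto intro!: derivative_eq_intros smooth_on_has_derivative[OF assms])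
  moreover have "(\<lambda>h. ?D (h *\<^sub>R v)) = (*) (?D v)"
    using linear_cmul[OF linear_ddir[OF assms]] by (simp add: fun_eq_iff)
  ultimately show ?thesis by (simp add: has_field_derivative_def)
qed

text \<open>
  The second difference quotient is symmetric in \<open>a\<close> and \<open>b\<close>, so this limit yields the symmetry of the
  second derivative. The mean value theorem is applied first in direction \<open>a\<close>, to the difference of
  two translates of \<open>f\<close>, and then in direction \<open>b\<close>.
\<close>

lemma second_difference_tendsto_D2:
  fixes f :: "'a::euclidean_space \<Rightarrow> real"
  assumes U: "open U" "x \<in> U" and f: "smooth_on U f"
  shows "((\<lambda>t. (f (x + t *\<^sub>R a + t *\<^sub>R b) - f (x + t *\<^sub>R a) - f (x + t *\<^sub>R b) + f x) / t\<^sup>2)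
           \<longlongrightarrow> D2 f x a b) (at_right 0)"
    (is "((\<lambda>t. ?\<Delta> t / t\<^sup>2) \<longlongrightarrow> _) _")
proof -
  obtain r where r: "r > 0" "ball x r \<subseteq> U" using U open_contains_ball by blast
  have inU: "x + s *\<^sub>R a + t *\<^sub>R b \<in> U" if "\<bar>s\<bar> * norm a + \<bar>t\<bar> * norm b < r" for s t
  proof -
    have "norm (s *\<^sub>R a + t *\<^sub>R b) \<le> \<bar>s\<bar> * norm a + \<bar>t\<bar> * norm b"
      by (metis norm_scaleR norm_triangle_ineq)
    moreover have "dist (x + s *\<^sub>R a + t *\<^sub>R b) x = norm (s *\<^sub>R a + t *\<^sub>R b)"
      by (metis add.assoc add_diff_cancel_left' dist_norm)
    ultimately have "x + s *\<^sub>R a + t *\<^sub>R b \<in> ball x r" using that by (simp add: dist_commute)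
    then show ?thesis using r by blast
  qed
  let ?H = "ddir b (ddir a f)"
  have mvt: "\<exists>\<sigma> \<tau>. 0 \<le> \<sigma> \<and> \<sigma> \<le> t \<and> 0 \<le> \<tau> \<and> \<tau> \<le> t \<and> ?\<Delta> t / t\<^sup>2 = ?H (x + \<sigma> *\<^sub>R a + \<tau> *\<^sub>R b)"
    if t: "0 < t" "t * norm a + t * norm b < r" for t
  proof -
    have small: "x + s *\<^sub>R a + s' *\<^sub>R b \<in> U" if "0 \<le> s" "s \<le> t" "0 \<le> s'" "s' \<le> t" for s s'
    proof (rule inU)
      have "\<bar>s\<bar> * norm a + \<bar>s'\<bar> * norm b \<le> t * norm a + t * norm b"
        using that by (intro add_mono mult_right_mono) auto
      then show "\<bar>s\<bar> * norm a + \<bar>s'\<bar> * norm b < r" using t by simp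
    qed
    have "\<exists>\<sigma>. 0 < \<sigma> \<and> \<sigma> < t \<and>
        (f ((x + t *\<^sub>R b) + t *\<^sub>R a) - f (x + t *\<^sub>R a)) - (f ((x + t *\<^sub>R b) + 0 *\<^sub>R a) - f (x + 0 *\<^sub>R a))
          = (t - 0) * (ddir a f ((x + t *\<^sub>R b) + \<sigma> *\<^sub>R a) - ddir a f (x + \<sigma> *\<^sub>R a))"
      using small[of _ t] small[of _ 0] t(1)
      by (intro MVT2 DERIV_diff smooth_on_line_DERIV[OF f]) (auto simp: add_ac)
    then obtain \<sigma> where \<sigma>: "0 < \<sigma>" "\<sigma> < t"
      "?\<Delta> t = t * (ddir a f ((x + t *\<^sub>R b) + \<sigma> *\<^sub>R a) - ddir a f (x + \<sigma> *\<^sub>R a))"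
      by (auto simp: add_ac)
    have "\<exists>\<tau>. 0 < \<tau> \<and> \<tau> < t \<and>
        ddir a f ((x + \<sigma> *\<^sub>R a) + t *\<^sub>R b) - ddir a f ((x + \<sigma> *\<^sub>R a) + 0 *\<^sub>R b)
          = (t - 0) * ?H ((x + \<sigma> *\<^sub>R a) + \<tau> *\<^sub>R b)"
      using small[of \<sigma>] \<sigma> t(1)
      by (intro MVT2 smooth_on_line_DERIV[OF smooth_on_ddir[OF f]]) auto
    then obtain \<tau> where \<tau>: "0 < \<tau>" "\<tau> < t"
      "ddir a f ((x + \<sigma> *\<^sub>R a) + t *\<^sub>R b) - ddir a f (x + \<sigma> *\<^sub>R a) = t * ?H ((x + \<sigma> *\<^sub>R a) + \<tau> *\<^sub>R b)"
      by auto
    have "?\<Delta> t = t * (t * ?H (x + \<sigma> *\<^sub>R a + \<tau> *\<^sub>R b))"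
      using \<sigma>(3) \<tau>(3) by (simp add: add_ac)
    then have "?\<Delta> t / t\<^sup>2 = ?H (x + \<sigma> *\<^sub>R a + \<tau> *\<^sub>R b)" using t(1) by (simp add: power2_eq_square)
    then show ?thesis using \<sigma> \<tau> by (intro exI[of _ \<sigma>] exI[of _ \<tau>]) simp
  qed
  have contH: "isCont ?H x"
    using smooth_on_continuous[OF smooth_on_ddir[OF smooth_on_ddir[OF f]]] U
    by (simp add: continuous_on_eq_continuous_at)
  show ?thesis
  proof (rule tendstoI)
    fix e :: real assume "e > 0"
    then obtain d where d: "d > 0" "\<And>y. dist y x < d \<Longrightarrow> dist (?H y) (?H x) < e"
      using contH unfolding continuous_at_eps_delta by blast
    let ?K = "norm a + norm b + 1"
    have K: "?K > 0" by (simp add: add_nonneg_pos)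
    have "\<forall>\<^sub>F t in at_right 0. t < min d r / ?K \<and> t > 0"
      using K d r by (intro eventually_conj eventually_at_rightI[of 0 "min d r / ?K"]
        eventually_at_right_less) auto
    then show "\<forall>\<^sub>F t in at_right 0. dist (?\<Delta> t / t\<^sup>2) (D2 f x a b) < e"
    proof eventually_elim
      case (elim t)
      then have "t * ?K < min d r" using K by (simp add: pos_less_divide_eq)
      then have tt: "t * norm a + t * norm b < min d r" using elim by (simp add: algebra_simps)
      then obtain \<sigma> \<tau> where st: "0 \<le> \<sigma>" "\<sigma> \<le> t" "0 \<le> \<tau>" "\<tau> \<le> t"
        "?\<Delta> t / t\<^sup>2 = ?H (x + \<sigma> *\<^sub>R a + \<tau> *\<^sub>R b)" using mvt[of t] elim by auto
      have "dist (x + \<sigma> *\<^sub>R a + \<tau> *\<^sub>R b) x = norm (\<sigma> *\<^sub>R a + \<tau> *\<^sub>R b)"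
        by (metis add.assoc add_diff_cancel_left' dist_norm)
      also have "\<dots> \<le> \<bar>\<sigma>\<bar> * norm a + \<bar>\<tau>\<bar> * norm b" by (metis norm_scaleR norm_triangle_ineq)
      also have "\<dots> \<le> t * norm a + t * norm b"
        using st by (intro add_mono mult_right_mono) auto
      finally show ?case using d(2) tt st(5) by (simp add: D2_def)
    qed
  qed
qed

lemma D2_commute_real:
  fixes f :: "'a::euclidean_space \<Rightarrow> real"
  assumes "open U" "x \<in> U" "smooth_on U f"
  shows "D2 f x a b = D2 f x b a"
proof (rule tendsto_unique)
  show "((\<lambda>t. (f (x + t *\<^sub>R b + t *\<^sub>R a) - f (x + t *\<^sub>R b) - f (x + t *\<^sub>R a) + f x) / t\<^sup>2)
           \<longlongrightarrow> D2 f x a b) (at_right 0)"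
    using second_difference_tendsto_D2[OF assms, of a b] by (simp add: algebra_simps)
qed (use second_difference_tendsto_D2[OF assms, of b a] in auto)

lemma D2_commute:
  fixes f :: "'a::euclidean_space \<Rightarrow> 'b::euclidean_space"
  assumes "open U" "x \<in> U" "smooth_on U f"
  shows "D2 f x a b = D2 f x b a"
proof (rule vector_eq_rdot[THEN iffD1], rule allI)
  fix \<nu> :: 'b
  have L: "linear (\<lambda>y. y \<bullet> \<nu>)" by (simp add: bounded_linear.linear bounded_linear_inner_left)
  show "D2 f x a b \<bullet> \<nu> = D2 f x b a \<bullet> \<nu>"
    using D2_commute_real[OF assms(1,2) smooth_on_linear_image[OF L assms(1,3)]]
      D2_linear_image[OF L assms(1,3,2)] by metis
qed

text \<open>
  Linearity in the last direction is that of a derivative; symmetry transfers it to the other one.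
\<close>

lemma linear_D2:
  fixes f :: "'a::euclidean_space \<Rightarrow> 'b::euclidean_space"
  assumes "open U" "x \<in> U" "smooth_on U f"
  shows "linear (D2 f x a)" "linear (\<lambda>a. D2 f x a b)"
proof -
  have lin: "linear (D2 f x c)" for c
    using linear_ddir[OF smooth_on_ddir[OF assms(3)] assms(2)] by (simp add: D2_def[abs_def])
  show "linear (D2 f x a)" by (rule lin)
  have "(\<lambda>a. D2 f x a b) = D2 f x b" using D2_commute[OF assms] by auto
  then show "linear (\<lambda>a. D2 f x a b)" using lin by simp
qed

text \<open>
  Taylor's formula with Lagrange remainder along the line \<open>t v\<close>; continuity of the \<open>n\<close>-th derivative
  turns the remainder into a limit.
\<close>

lemma taylor_line_leading_term:
  fixes f :: "'a::euclidean_space \<Rightarrow> real"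
  assumes U: "open U" "0 \<in> U" and f: "smooth_on U f"
    and vanish: "\<And>m. 0 < m \<Longrightarrow> m < n \<Longrightarrow> (ddir v ^^ m) f 0 = 0" and n: "0 < n"
  shows "((\<lambda>t. (f (t *\<^sub>R v) - f 0) / t ^ n) \<longlongrightarrow> (ddir v ^^ n) f 0 / fact n) (at 0)"
proof -
  let ?d = "\<lambda>m t. (ddir v ^^ m) f (t *\<^sub>R v)"
  have smooth: "smooth_on U ((ddir v ^^ m) f)" for m
    by (induction m) (simp_all add: f smooth_on_ddir)
  have "continuous (at 0) (\<lambda>t. t *\<^sub>R v)" by (intro continuous_intros)
  then have line0: "((\<lambda>t. t *\<^sub>R v) \<longlongrightarrow> 0) (at 0)" by (simp add: isCont_def)
  obtain r where r: "r > 0" "\<And>t. \<bar>t\<bar> < r \<Longrightarrow> t *\<^sub>R v \<in> U"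
  proof -
    have "\<forall>\<^sub>F t in nhds 0. t *\<^sub>R v \<in> U"
      using topological_tendstoD[OF line0 U] U(2)
      by (auto simp: eventually_at_filter elim!: eventually_mono)
    then show ?thesis using that by (auto simp: eventually_nhds_metric dist_norm)
  qed
  have der: "(?d m has_real_derivative ?d (Suc m) t) (at t)" if "\<bar>t\<bar> < r" for m t
    using smooth_on_line_DERIV[OF smooth, of 0 t v] r(2)[OF that] by simp
  have mac: "\<exists>s. \<bar>s\<bar> \<le> \<bar>t\<bar> \<and> (f (t *\<^sub>R v) - f 0) / t ^ n = ?d n s / fact n" if t: "\<bar>t\<bar> < r" "t \<noteq> 0" for t
  proof -
    have "\<exists>s. \<bar>s\<bar> \<le> \<bar>t\<bar> \<and> f (t *\<^sub>R v) = (\<Sum>m<n. ?d m 0 / fact m * t ^ m) + ?d n s / fact n * t ^ n"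
      using der t by (intro Maclaurin_bi_le) auto
    then obtain s where s: "\<bar>s\<bar> \<le> \<bar>t\<bar>" "f (t *\<^sub>R v) = (\<Sum>m<n. ?d m 0 / fact m * t ^ m) + ?d n s / fact n * t ^ n"
      by blast
    have "(\<Sum>m<n. ?d m 0 / fact m * t ^ m) = (\<Sum>m\<in>{0}. ?d m 0 / fact m * t ^ m)"
      using n vanish by (intro sum.mono_neutral_right) auto
    then show ?thesis using s t by (intro exI[of _ s]) (simp add: field_simps)
  qed
  have "isCont (?d n) 0" using der[of 0 n] r(1) DERIV_isCont by auto
  show ?thesis
  proof (rule tendstoI)
    fix e :: real assume "e > 0"
    then have "e * fact n > 0" by simp
    then obtain d where d: "d > 0" "\<And>s. dist s 0 < d \<Longrightarrow> dist (?d n s) (?d n 0) < e * fact n"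
      using \<open>isCont (?d n) 0\<close> unfolding continuous_at_eps_delta by blast
    have "\<forall>\<^sub>F t in at 0. \<bar>t\<bar> < min d r \<and> t \<noteq> 0"
      unfolding eventually_at by (rule exI[of _ "min d r"]) (use d r in auto)
    then show "\<forall>\<^sub>F t in at 0. dist ((f (t *\<^sub>R v) - f 0) / t ^ n) ((ddir v ^^ n) f 0 / fact n) < e"
    proof eventually_elim
      case (elim t)
      then obtain s where s: "\<bar>s\<bar> \<le> \<bar>t\<bar>" "(f (t *\<^sub>R v) - f 0) / t ^ n = ?d n s / fact n" using mac[of t] by auto
      have "dist (?d n s) (?d n 0) < e * fact n" using d(2)[of s] s elim by simp
      then have "\<bar>?d n s - ?d n 0\<bar> / fact n < e"
        by (simp add: dist_real_def pos_divide_less_eq)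
      moreover have "\<bar>?d n s / fact n - ?d n 0 / fact n\<bar> = \<bar>?d n s - ?d n 0\<bar> / fact n"
        by (simp flip: diff_divide_distrib)
      ultimately show ?case using s by (simp add: dist_real_def)
    qed
  qed
qed

section \<open>Singularities of functions seen along lines\<close>

text \<open>
  The curve \<open>c v\<close> is the preimage of the line \<open>t v\<close>. Its velocity at \<open>0\<close> is \<open>S v\<close>, where \<open>S\<close> is the
  derivative of the inverse diffeomorphism, so all velocities occur and only \<open>v = 0\<close> has velocity \<open>0\<close>.
\<close>

lemma germ_diffeo_lines:
  fixes \<Phi> :: "'a::euclidean_space \<Rightarrow> 'a"
  assumes "germ_diffeo \<Phi>"
  obtains S :: "'a \<Rightarrow> 'a" and c :: "'a \<Rightarrow> real \<Rightarrow> 'a" where "linear S" "bij S"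
    "\<And>v. \<forall>\<^sub>F t in at (0::real). \<Phi> (c v t) = t *\<^sub>R v"
    "\<And>v. (c v \<longlongrightarrow> 0) (at 0)"
    "\<And>v w. ((\<lambda>t. (c v t \<bullet> w) / t) \<longlongrightarrow> S v \<bullet> w) (at 0)"
proof -
  from assms obtain U V \<Psi> where *: "\<Phi> 0 = 0" "open U" "open V" "0 \<in> U" "smooth_on U \<Phi>"
    "smooth_on V \<Psi>" "homeomorphism U V \<Phi> \<Psi>"
    unfolding germ_diffeo_def by blast
  have V0: "0 \<in> V" and \<Psi>0: "\<Psi> 0 = 0"
    using * by (auto simp: homeomorphism_def)
  have inv: "\<Phi> (\<Psi> y) = y" if "y \<in> V" for y using * that by (auto simp: homeomorphism_def)
  define S where "S = (\<lambda>v. ddir v \<Psi> 0)"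
  have S: "(\<Psi> has_derivative S) (at 0)"
    unfolding S_def by (rule smooth_on_has_derivative[OF *(6) V0])
  have D: "(\<Phi> has_derivative (\<lambda>v. ddir v \<Phi> 0)) (at (\<Psi> 0))"
    using smooth_on_has_derivative[OF *(5) *(4)] \<Psi>0 by simp
  have "((\<lambda>y. \<Phi> (\<Psi> y)) has_derivative (\<lambda>v. ddir (S v) \<Phi> 0)) (at 0)"
    by (rule has_derivative_compose[OF S D])
  moreover have "((\<lambda>y. \<Phi> (\<Psi> y)) has_derivative (\<lambda>v. v)) (at 0)"
    by (rule has_derivative_transform_within_open[OF has_derivative_ident *(3) V0]) (simp add: inv)
  ultimately have left_inv: "(\<lambda>v. ddir (S v) \<Phi> 0) = (\<lambda>v. v)" by (rule has_derivative_unique)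
  have "linear S" using S has_derivative_linear by blast
  moreover have "inj S" using left_inv by (metis injI)
  ultimately have "bij S" by (simp add: bij_def linear_injective_imp_surjective)
  have "((\<lambda>t::real. t *\<^sub>R v) \<longlongrightarrow> 0 *\<^sub>R v) (at 0)" for v :: 'a
    by (intro tendsto_intros)
  then have line0: "((\<lambda>t::real. t *\<^sub>R v) \<longlongrightarrow> 0) (at 0)" for v :: 'a by simp
  show ?thesis
  proof
    fix v w :: 'a
    have "\<forall>\<^sub>F t in at (0::real). t *\<^sub>R v \<in> V"
      using topological_tendstoD[OF line0 *(3) V0] .
    then show "\<forall>\<^sub>F t in at (0::real). \<Phi> (\<Psi> (t *\<^sub>R v)) = t *\<^sub>R v"
      by eventually_elim (rule inv)
    have "isCont \<Psi> 0" using S has_derivative_continuous by blast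
    then show "((\<lambda>t::real. \<Psi> (t *\<^sub>R v)) \<longlongrightarrow> 0) (at 0)"
      using isCont_tendsto_compose[OF _ line0] \<Psi>0 by metis
    have "((\<lambda>t. \<Psi> (t *\<^sub>R v) \<bullet> w) has_derivative (\<lambda>h. S (h *\<^sub>R v) \<bullet> w)) (at 0)"
      by (intro has_derivative_inner_left has_derivative_compose[where f = "\<lambda>t. t *\<^sub>R v" and g = \<Psi>])
        (auto intro!: derivative_eq_intros S)
    moreover have "(\<lambda>h. S (h *\<^sub>R v) \<bullet> w) = (*) (S v \<bullet> w)"
      by (simp add: fun_eq_iff linear_cmul[OF \<open>linear S\<close>])
    ultimately have "((\<lambda>t. \<Psi> (t *\<^sub>R v) \<bullet> w) has_real_derivative S v \<bullet> w) (at 0)"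
      by (simp add: has_field_derivative_def)
    then show "((\<lambda>t. (\<Psi> (t *\<^sub>R v) \<bullet> w) / t) \<longlongrightarrow> S v \<bullet> w) (at 0)"
      by (simp add: DERIV_def \<Psi>0)
  qed fact+
qed

lemma right_equiv_lines:
  assumes "right_equiv (\<lambda>x. f x - f 0) g"
  obtains S :: "real^2 \<Rightarrow> real^2" and c :: "real^2 \<Rightarrow> real \<Rightarrow> real^2" where "linear S" "bij S"
    "\<And>v. \<forall>\<^sub>F t in at (0::real). f (t *\<^sub>R v) - f 0 = g (c v t)"
    "\<And>v i. ((\<lambda>t. (c v t $ i) / t) \<longlongrightarrow> S v $ i) (at 0)"
proof -
  from assms obtain \<Phi> where \<Phi>: "germ_diffeo \<Phi>" "\<forall>\<^sub>F x in nhds 0. f (\<Phi> x) - f 0 = g x"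
    unfolding right_equiv_def by blast
  obtain S :: "real^2 \<Rightarrow> real^2" and c :: "real^2 \<Rightarrow> real \<Rightarrow> real^2" where *: "linear S" "bij S"
    "\<And>v. \<forall>\<^sub>F t in at (0::real). \<Phi> (c v t) = t *\<^sub>R v"
    "\<And>v. (c v \<longlongrightarrow> 0) (at 0)"
    "\<And>v w. ((\<lambda>t. (c v t \<bullet> w) / t) \<longlongrightarrow> S v \<bullet> w) (at 0)"
    using germ_diffeo_lines[OF \<Phi>(1)] by blast
  show ?thesis
  proof (rule that[OF *(1,2)])
    fix v :: "real^2" and i :: 2
    have "\<forall>\<^sub>F t in at 0. f (\<Phi> (c v t)) - f 0 = g (c v t)"
      using eventually_compose_filterlim[OF \<Phi>(2) *(4)] .
    with *(3)[of v] show "\<forall>\<^sub>F t in at 0. f (t *\<^sub>R v) - f 0 = g (c v t)"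
      by eventually_elim simp
    show "((\<lambda>t. (c v t $ i) / t) \<longlongrightarrow> S v $ i) (at 0)"
      using *(5)[of v "axis i 1"] by (simp add: inner_axis)
  qed
qed

text \<open>
  A function of order \<open>t\<close> has an \<open>m\<close>-th power of order \<open>t ^ m\<close>; only the case \<open>m = n\<close> leaves a
  contribution in the limit.
\<close>

lemma tendsto_power_over_power:
  fixes h :: "real \<Rightarrow> real"
  assumes "((\<lambda>t. h t / t) \<longlongrightarrow> l) (at 0)" "n \<le> m"
  shows "((\<lambda>t. h t ^ m / t ^ n) \<longlongrightarrow> (if m = n then l ^ n else 0)) (at 0)"
proof -
  have "((\<lambda>t. (h t / t) ^ m * t ^ (m - n)) \<longlongrightarrow> l ^ m * 0 ^ (m - n)) (at 0)"
    by (intro tendsto_intros assms)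
  moreover have "\<forall>\<^sub>F t in at 0. (h t / t) ^ m * t ^ (m - n) = h t ^ m / t ^ n"
    unfolding eventually_at_filter
    using assms(2) by (auto simp: power_divide field_simps simp flip: power_add)
  ultimately show ?thesis
    using assms(2) by (auto simp: power_0_left intro: Lim_transform_eventually)
qed

text \<open>
  Comparison of the terms of order \<open>t\<^sup>2\<close> along the lines: the power of the second
  variable contributes only if its exponent \<open>k + 1\<close> equals 2.
\<close>

lemma A_sing_Hessian:
  assumes U: "open U" "0 \<in> U" and f: "smooth_on U f"
    and crit: "\<And>v. ddir v f 0 = 0" and A: "A_sing k f" and k: "k \<ge> 1"
  obtains S :: "real^2 \<Rightarrow> real^2" and \<epsilon> \<delta> where "linear S" "bij S" "\<epsilon> \<in> {1,-1::real}" "\<delta> \<in> {1,-1::real}"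
    "\<And>v. D2 f 0 v v / 2 = \<epsilon> * (S v $ 1)\<^sup>2 + (if k = 1 then \<delta> * (S v $ 2)\<^sup>2 else 0)"
proof -
  from A obtain \<epsilon> \<delta> where ed: "\<epsilon> \<in> {1,-1}" "\<delta> \<in> {1,-1}"
    "right_equiv (\<lambda>x. f x - f 0) (\<lambda>x. \<epsilon> * (x$1)^2 + \<delta> * (x$2)^(k+1))"
    unfolding A_sing_def by blast
  obtain S :: "real^2 \<Rightarrow> real^2" and c :: "real^2 \<Rightarrow> real \<Rightarrow> real^2" where S: "linear S" "bij S"
    and ev: "\<And>v. \<forall>\<^sub>F t in at (0::real). f (t *\<^sub>R v) - f 0 = \<epsilon> * (c v t $ 1)^2 + \<delta> * (c v t $ 2)^(k+1)"
    and c: "\<And>v i. ((\<lambda>t. (c v t $ i) / t) \<longlongrightarrow> S v $ i) (at 0)"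
    using right_equiv_lines[OF ed(3)] by blast
  show ?thesis
  proof (rule that[OF S ed(1,2)])
    fix v
    have "((\<lambda>t. (f (t *\<^sub>R v) - f 0) / t ^ 2) \<longlongrightarrow> (ddir v ^^ 2) f 0 / fact 2) (at 0)"
      using crit by (intro taylor_line_leading_term[OF U f]) (auto simp: less_2_cases_iff)
    then have 1: "((\<lambda>t. (f (t *\<^sub>R v) - f 0) / t ^ 2) \<longlongrightarrow> D2 f 0 v v / 2) (at 0)"
      by (simp add: D2_def numeral_2_eq_2)
    have "((\<lambda>t. \<epsilon> * ((c v t $ 1)^2 / t^2) + \<delta> * ((c v t $ 2)^(k+1) / t^2)) \<longlongrightarrow>
            \<epsilon> * (if 2 = (2::nat) then (S v $ 1)^2 else 0) + \<delta> * (if k + 1 = 2 then (S v $ 2)^2 else 0)) (at 0)"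
      using k by (intro tendsto_intros tendsto_power_over_power c) auto
    moreover have "\<forall>\<^sub>F t in at 0. \<epsilon> * ((c v t $ 1)^2 / t^2) + \<delta> * ((c v t $ 2)^(k+1) / t^2)
         = (f (t *\<^sub>R v) - f 0) / t ^ 2"
      using ev[of v] by eventually_elim (simp add: add_divide_distrib)
    ultimately have "((\<lambda>t. (f (t *\<^sub>R v) - f 0) / t ^ 2) \<longlongrightarrow>
            \<epsilon> * (S v $ 1)^2 + \<delta> * (if k + 1 = 2 then (S v $ 2)^2 else 0)) (at 0)"
      by (auto intro: Lim_transform_eventually)
    from tendsto_unique[OF _ 1 this]
    show "D2 f 0 v v / 2 = \<epsilon> * (S v $ 1)\<^sup>2 + (if k = 1 then \<delta> * (S v $ 2)\<^sup>2 else 0)" by auto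
  qed
qed

lemma A_sing_Hessian_nonzero:
  assumes "open U" "0 \<in> U" "smooth_on U f" "\<And>v. ddir v f 0 = 0" "A_sing k f" "k \<ge> 1"
  shows "\<exists>v. D2 f 0 v v \<noteq> 0"
proof -
  obtain S :: "real^2 \<Rightarrow> real^2" and \<epsilon> \<delta> where S: "linear S" "bij S" "\<epsilon> \<in> {1,-1::real}" "\<delta> \<in> {1,-1::real}"
    "\<And>v. D2 f 0 v v / 2 = \<epsilon> * (S v $ 1)\<^sup>2 + (if k = 1 then \<delta> * (S v $ 2)\<^sup>2 else 0)"
    using A_sing_Hessian[OF assms] by blast
  obtain v where "S v = axis 1 1" using S(2) by (metis bij_pointE)
  then have "D2 f 0 v v / 2 = \<epsilon>" using S(5)[of v] by (simp add: axis_def)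
  then show ?thesis using S(3) by (intro exI[of _ v]) auto
qed

text \<open>
  A vector in the kernel would, by polarization, be orthogonal to everything
  for the nondegenerate form of signs \<open>\<epsilon>, \<delta>\<close>.
\<close>

lemma A1_Hessian_nondegenerate:
  assumes U: "open U" "0 \<in> U" and f: "smooth_on U f"
    and crit: "\<And>v. ddir v f 0 = 0" and A: "A_sing 1 f" and v: "v \<noteq> 0"
  shows "\<exists>w. D2 f 0 v w \<noteq> 0"
proof (rule ccontr)
  assume "\<not> ?thesis"
  then have ker: "D2 f 0 v w = 0" for w by simp
  obtain S :: "real^2 \<Rightarrow> real^2" and \<epsilon> \<delta> where S: "linear S" "bij S" "\<epsilon> \<in> {1,-1::real}" "\<delta> \<in> {1,-1::real}"
    "\<And>v. D2 f 0 v v / 2 = \<epsilon> * (S v $ 1)\<^sup>2 + (if (1::nat) = 1 then \<delta> * (S v $ 2)\<^sup>2 else 0)"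
    using A_sing_Hessian[OF U f crit A] by auto
  have quad: "D2 f 0 v v / 2 = \<epsilon> * (S v $ 1)\<^sup>2 + \<delta> * (S v $ 2)\<^sup>2" for v
    using S(5)[of v] by (simp only: if_True refl simp_thms)
  have polar: "\<epsilon> * (S v $ 1) * (S w $ 1) + \<delta> * (S v $ 2) * (S w $ 2) = 0" for w
  proof -
    have "D2 f 0 (v + w) (v + w) = D2 f 0 w w"
    proof -
      have "D2 f 0 (v + w) (v + w) = D2 f 0 v (v + w) + D2 f 0 w (v + w)"
        by (rule linear_add[OF linear_D2(2)[OF U f]])
      also have "\<dots> = D2 f 0 w v + D2 f 0 w w"
        using ker linear_add[OF linear_D2(1)[OF U f], of w v w] by simp
      finally show ?thesis using ker D2_commute[OF U f, of w v] by simp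
    qed
    moreover have "D2 f 0 (v + w) (v + w) / 2 =
        \<epsilon> * (S v $ 1 + S w $ 1)\<^sup>2 + \<delta> * (S v $ 2 + S w $ 2)\<^sup>2"
      using quad[of "v + w"] unfolding linear_add[OF S(1)] vector_add_component .
    ultimately have
      "\<epsilon> * (S v $ 1 + S w $ 1)\<^sup>2 + \<delta> * (S v $ 2 + S w $ 2)\<^sup>2 = \<epsilon> * (S w $ 1)\<^sup>2 + \<delta> * (S w $ 2)\<^sup>2"
      using quad[of w] by metis
    moreover have "\<epsilon> * (S v $ 1)\<^sup>2 + \<delta> * (S v $ 2)\<^sup>2 = 0"
      using quad[of v] unfolding ker by simp
    ultimately show ?thesis unfolding power2_sum by (simp add: algebra_simps)
  qed
  obtain w1 w2 where "S w1 = axis 1 1" "S w2 = axis 2 1" using S(2) by (metis bij_pointE)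
  then have "\<epsilon> * S v $ 1 = 0" "\<delta> * S v $ 2 = 0"
    using polar[of w1] polar[of w2] by (simp_all add: axis_def)
  then have "S v $ 1 = 0" "S v $ 2 = 0" using S(3,4) by fastforce+
  then have "S v = 0" by (simp add: vec_eq_iff forall_2)
  then have "S v = S 0" by (simp only: linear_0[OF S(1)])
  then show False using v S(2) by (metis bij_pointE)
qed

text \<open>
  Otherwise \<open>f - f 0\<close> is \<open>o(t\<^sup>3)\<close> on the line \<open>t v\<close>, that is,
  \<open>\<epsilon> x\<^sub>1\<^sup>2 + \<delta> x\<^sub>2\<^sup>3\<close> is \<open>o(t\<^sup>3)\<close> on the corresponding curve. The cubic term changes sign with \<open>t\<close> and the
  square does not, so on one side of \<open>0\<close> they cannot cancel; this forces both components of the velocity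
  to vanish.
\<close>

lemma A2_cubic_nonzero:
  assumes U: "open U" "0 \<in> U" and f: "smooth_on U f"
    and crit: "\<And>v. ddir v f 0 = 0" and A: "A_sing 2 f" and v: "v \<noteq> 0" and "D2 f 0 v v = 0"
  shows "D3 f 0 v v v \<noteq> 0"
proof
  assume "D3 f 0 v v v = 0"
  from A obtain \<epsilon> \<delta> where ed: "\<epsilon> \<in> {1,-1}" "\<delta> \<in> {1,-1}"
    "right_equiv (\<lambda>x. f x - f 0) (\<lambda>x. \<epsilon> * (x$1)^2 + \<delta> * (x$2)^(2+1))"
    unfolding A_sing_def by blast
  obtain S :: "real^2 \<Rightarrow> real^2" and c :: "real^2 \<Rightarrow> real \<Rightarrow> real^2" where S: "linear S" "bij S"
    and ev: "\<And>v. \<forall>\<^sub>F t in at (0::real). f (t *\<^sub>R v) - f 0 = \<epsilon> * (c v t $ 1)^2 + \<delta> * (c v t $ 2)^(2+1)"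
    and c: "\<And>v i. ((\<lambda>t. (c v t $ i) / t) \<longlongrightarrow> S v $ i) (at 0)"
    using right_equiv_lines[OF ed(3)] by blast
  have "((\<lambda>t. (f (t *\<^sub>R v) - f 0) / t ^ 3) \<longlongrightarrow> (ddir v ^^ 3) f 0 / fact 3) (at 0)"
    using crit assms(7)
    by (intro taylor_line_leading_term[OF U f])
      (auto simp: D2_def numeral_3_eq_3 numeral_2_eq_2 less_Suc_eq)
  then have lim: "((\<lambda>t. (f (t *\<^sub>R v) - f 0) / t ^ 3) \<longlongrightarrow> 0) (at 0)"
    using \<open>D3 f 0 v v v = 0\<close> by (simp add: D3_def numeral_3_eq_3)
  have "((\<lambda>t. (f (t *\<^sub>R v) - f 0) / t ^ 3 - \<delta> * ((c v t $ 2)^3 / t^3)) \<longlongrightarrow>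
      0 - \<delta> * (if 3 = (3::nat) then (S v $ 2)^3 else 0)) (at 0)"
    by (intro tendsto_intros tendsto_power_over_power c lim) auto
  moreover have "\<forall>\<^sub>F t in at 0. (f (t *\<^sub>R v) - f 0) / t ^ 3 - \<delta> * ((c v t $ 2)^3 / t^3)
      = \<epsilon> * (c v t $ 1)^2 / t^3"
    using ev[of v] by eventually_elim (simp add: add_divide_distrib)
  \<comment> \<open>What the cubic term leaves over is the square, of constant sign, divided by \<open>t\<^sup>3\<close>.\<close>
  ultimately have sq: "((\<lambda>t. \<epsilon> * (c v t $ 1)^2 / t^3) \<longlongrightarrow> - \<delta> * (S v $ 2)^3) (at 0)"
    by (auto intro: Lim_transform_eventually)
  have quotient_limit: "((\<lambda>t. (c v t $ 1)^2 / t^3) \<longlongrightarrow> - \<epsilon> * \<delta> * (S v $ 2)^3) (at 0 within T)" for T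
  proof -
    have "((\<lambda>t. \<epsilon> * (\<epsilon> * (c v t $ 1)^2 / t^3)) \<longlongrightarrow> \<epsilon> * (- \<delta> * (S v $ 2)^3)) (at 0)"
      by (intro tendsto_intros sq)
    then have "((\<lambda>t. (c v t $ 1)^2 / t^3) \<longlongrightarrow> - \<epsilon> * \<delta> * (S v $ 2)^3) (at 0)"
      using ed(1) by (auto simp: mult.assoc)
    then show ?thesis using tendsto_within_subset by blast
  qed
  have "\<forall>\<^sub>F t in at_right 0. (c v t $ 1)^2 / t^3 \<ge> 0"
    using eventually_at_right_less[of "0::real"] by eventually_elim simp
  \<comment> \<open>The limit from the right is nonnegative and the limit from the left nonpositive.\<close>
  then have "- \<epsilon> * \<delta> * (S v $ 2)^3 \<ge> 0" using tendsto_lowerbound[OF quotient_limit] trivial_limit_at_right_real by blast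
  moreover have "\<forall>\<^sub>F t in at_left (0::real). t < 0"
    by (simp add: eventually_at_filter)
  then have "\<forall>\<^sub>F t in at_left 0. (c v t $ 1)^2 / t^3 \<le> 0"
    by eventually_elim (simp add: divide_le_0_iff)
  then have "- \<epsilon> * \<delta> * (S v $ 2)^3 \<le> 0" using tendsto_upperbound[OF quotient_limit] trivial_limit_at_left_real by blast
  ultimately have "S v $ 2 = 0" using ed by auto
  have "((\<lambda>t. ((c v t $ 1)^2 / t^3) * t) \<longlongrightarrow> - \<epsilon> * \<delta> * (S v $ 2)^3 * 0) (at 0)"
    by (intro tendsto_intros quotient_limit)
  moreover have "\<forall>\<^sub>F t in at 0. ((c v t $ 1)^2 / t^3) * t = (c v t $ 1)^2 / t^2"
    by (auto simp: eventually_at_filter power2_eq_square power3_eq_cube)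
  ultimately have "((\<lambda>t. (c v t $ 1)^2 / t^2) \<longlongrightarrow> 0) (at 0)"
    by (auto intro: Lim_transform_eventually)
  moreover have "((\<lambda>t. (c v t $ 1)^2 / t^2) \<longlongrightarrow> (if 2 = (2::nat) then (S v $ 1)^2 else 0)) (at 0)"
    by (intro tendsto_power_over_power c) auto
  ultimately have "S v $ 1 = 0" using tendsto_unique[of "at (0::real)"] by fastforce
  with \<open>S v $ 2 = 0\<close> have "S v = 0" by (simp add: vec_eq_iff forall_2)
  then have "S v = S 0" by (simp only: linear_0[OF S(1)])
  then show False using v S(2) by (metis bij_pointE)
qed

text \<open>
  The normal forms of \<open>D\<^sub>k\<close>, \<open>k \<ge> 4\<close>, have order 3.
\<close>

lemma D_sing_Hessian_zero:
  assumes U: "open U" "0 \<in> U" and f: "smooth_on U f"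
    and crit: "\<And>v. ddir v f 0 = 0" and D: "D_sing k f" and k: "k \<ge> 4"
  shows "D2 f 0 v v = 0"
proof -
  from D obtain \<epsilon> where ed: "right_equiv (\<lambda>x. f x - f 0) (\<lambda>x. (x$1)^2 * x$2 + \<epsilon> * (x$2)^(k-1))"
    unfolding D_sing_def by blast
  obtain S :: "real^2 \<Rightarrow> real^2" and c :: "real^2 \<Rightarrow> real \<Rightarrow> real^2" where S: "linear S" "bij S"
    and ev: "\<And>v. \<forall>\<^sub>F t in at (0::real). f (t *\<^sub>R v) - f 0 = (c v t $ 1)^2 * c v t $ 2 + \<epsilon> * (c v t $ 2)^(k-1)"
    and c: "\<And>v i. ((\<lambda>t. (c v t $ i) / t) \<longlongrightarrow> S v $ i) (at 0)"
    using right_equiv_lines[OF ed] by blast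
  have "((\<lambda>t. (f (t *\<^sub>R v) - f 0) / t ^ 2) \<longlongrightarrow> (ddir v ^^ 2) f 0 / fact 2) (at 0)"
    using crit by (intro taylor_line_leading_term[OF U f]) (auto simp: less_2_cases_iff)
  then have 1: "((\<lambda>t. (f (t *\<^sub>R v) - f 0) / t ^ 2) \<longlongrightarrow> D2 f 0 v v / 2) (at 0)"
    by (simp add: D2_def numeral_2_eq_2)
  have neq: "k - 1 \<noteq> 2" using k by simp
  have "((\<lambda>t. ((c v t $ 1)^2 / t^2) * ((c v t $ 2)^1 / t^0) + \<epsilon> * ((c v t $ 2)^(k-1) / t^2)) \<longlongrightarrow>
          (if 2 = (2::nat) then (S v $ 1)^2 else 0) * (if 1 = (0::nat) then (S v $ 2)^0 else 0)
           + \<epsilon> * (if k - 1 = 2 then (S v $ 2)^2 else 0)) (at 0)"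
    using k by (intro tendsto_intros tendsto_power_over_power c) auto
  moreover have "\<forall>\<^sub>F t in at 0. ((c v t $ 1)^2 / t^2) * ((c v t $ 2)^1 / t^0) + \<epsilon> * ((c v t $ 2)^(k-1) / t^2)
       = (f (t *\<^sub>R v) - f 0) / t ^ 2"
    using ev[of v] by eventually_elim (simp add: add_divide_distrib)
  ultimately have "((\<lambda>t. (f (t *\<^sub>R v) - f 0) / t ^ 2) \<longlongrightarrow> 0) (at 0)"
    using neq by (auto intro: Lim_transform_eventually)
  from tendsto_unique[OF _ 1 this] show ?thesis by simp
qed

section \<open>Planes spanned by three vectors and binary quadratic forms\<close>

text \<open>
  In coordinates of the plane with respect to an orthonormal basis \<open>b1, b2\<close>, let \<open>br\<close> be the
  determinant of two vectors. The relation is Cramer's rule \<open>br B C * A - br A C * B + br A B * C = 0\<close>, and a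
  nonzero \<open>\<nu>\<close> in the plane orthogonal to two vectors exists exactly if their determinant vanishes; for
  \<open>x A + y B\<close> and \<open>x B + y C\<close> this determinant is the quadratic form below.
\<close>

lemma plane_relation:
  fixes A B C :: "'a::euclidean_space"
  assumes dim2: "dim (span {A, B, C}) = 2"
  obtains \<alpha> \<beta> \<gamma> :: real where "\<alpha> \<noteq> 0 \<or> \<beta> \<noteq> 0 \<or> \<gamma> \<noteq> 0"
    "\<alpha> *\<^sub>R A + (2 * \<beta>) *\<^sub>R B + \<gamma> *\<^sub>R C = 0"
    "\<And>a b c. a *\<^sub>R A + (2 * b) *\<^sub>R B + c *\<^sub>R C = 0 \<Longrightarrow> \<exists>r. a = r * \<alpha> \<and> b = r * \<beta> \<and> c = r * \<gamma>"
    "\<And>x y. (\<exists>\<nu>\<in>span {A, B, C}. \<nu> \<noteq> 0 \<and> (x *\<^sub>R A + y *\<^sub>R B) \<bullet> \<nu> = 0 \<and> (x *\<^sub>R B + y *\<^sub>R C) \<bullet> \<nu> = 0)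
        \<longleftrightarrow> \<gamma> * x\<^sup>2 - 2 * \<beta> * x * y + \<alpha> * y\<^sup>2 = 0"
proof -
  let ?P = "span {A, B, C}"
  obtain D where D: "D \<subseteq> ?P" "pairwise orthogonal D" "\<And>x. x \<in> D \<Longrightarrow> norm x = 1"
    "independent D" "card D = dim ?P" "span D = ?P"
    using orthonormal_basis_subspace[OF subspace_span, of "{A, B, C}"] by metis
  obtain b1 b2 where b: "D = {b1, b2}" "b1 \<noteq> b2" using D(5) dim2 by (metis card_2_iff)
  have b12: "b1 \<bullet> b1 = 1" "b2 \<bullet> b2 = 1" "b1 \<bullet> b2 = 0" "b2 \<bullet> b1 = 0"
    using D(2,3) b by (auto simp: pairwise_def orthogonal_def norm_eq_1)
  have bP: "b1 \<in> ?P" "b2 \<in> ?P" using D(1) b by auto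
  have expand: "X = (X \<bullet> b1) *\<^sub>R b1 + (X \<bullet> b2) *\<^sub>R b2" if X: "X \<in> ?P" for X
  proof -
    obtain s t where "X = s *\<^sub>R b1 + t *\<^sub>R b2"
      using X unfolding D(6)[symmetric] b span_breakdown_eq[of _ b1] span_singleton
      by (auto simp: algebra_simps)
    then show ?thesis using b12 by (simp add: inner_add_left)
  qed
  define br where "br X Y = (X \<bullet> b1) * (Y \<bullet> b2) - (X \<bullet> b2) * (Y \<bullet> b1)" for X Y
  have ABC: "A \<in> ?P" "B \<in> ?P" "C \<in> ?P" by (auto intro: span_base)
  have zeroI: "X = 0" if "X \<in> ?P" "X \<bullet> b1 = 0" "X \<bullet> b2 = 0" for X
    using expand[OF that(1)] that by simp
  define \<alpha> \<beta> \<gamma> where "\<alpha> = br B C" and "\<beta> = - br A C / 2" and "\<gamma> = br A B"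
  have two_\<beta>: "2 * \<beta> = - br A C" by (simp add: \<beta>_def)
  show ?thesis
  proof (rule that)
    show "\<alpha> \<noteq> 0 \<or> \<beta> \<noteq> 0 \<or> \<gamma> \<noteq> 0"
    proof (rule ccontr)
      assume "\<not> ?thesis"
      then have br0: "br A B = 0" "br A C = 0" "br B C = 0" by (auto simp: \<alpha>_def \<beta>_def \<gamma>_def)
      have "X = 0" if X: "X \<in> {A, B, C}" for X
      proof -
        let ?\<nu> = "(X \<bullet> b1) *\<^sub>R b2 - (X \<bullet> b2) *\<^sub>R b1"
        have "orthogonal ?\<nu> Y" if "Y \<in> {A, B, C}" for Y
          using X that br0 unfolding orthogonal_def br_def
          by (auto simp: inner_diff_left inner_commute algebra_simps)
        moreover have "?\<nu> \<in> ?P" using bP by (intro span_diff span_scale)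
        ultimately have "orthogonal ?\<nu> ?\<nu>" using orthogonal_to_span by blast
        then have "?\<nu> = 0" by (simp only: orthogonal_self)
        then have "?\<nu> \<bullet> b1 = 0" "?\<nu> \<bullet> b2 = 0" by simp_all
        then have "X \<bullet> b1 = 0" "X \<bullet> b2 = 0" using b12 by (simp_all add: inner_diff_left)
        moreover have "X \<in> ?P" using X by (rule span_base)
        ultimately show ?thesis by (rule zeroI[rotated])
      qed
      then have "A = 0" "B = 0" "C = 0" by auto
      then show False using dim2 by simp
    qed
    show "\<alpha> *\<^sub>R A + (2 * \<beta>) *\<^sub>R B + \<gamma> *\<^sub>R C = 0"
    proof (rule zeroI)
      show "\<alpha> *\<^sub>R A + (2 * \<beta>) *\<^sub>R B + \<gamma> *\<^sub>R C \<in> ?P" using ABC by (intro span_add span_scale)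
      show "(\<alpha> *\<^sub>R A + (2 * \<beta>) *\<^sub>R B + \<gamma> *\<^sub>R C) \<bullet> b1 = 0"
        "(\<alpha> *\<^sub>R A + (2 * \<beta>) *\<^sub>R B + \<gamma> *\<^sub>R C) \<bullet> b2 = 0"
        unfolding two_\<beta> \<alpha>_def \<gamma>_def br_def by (simp_all add: inner_add_left algebra_simps)
    qed
    fix a b c
    assume rel: "a *\<^sub>R A + (2 * b) *\<^sub>R B + c *\<^sub>R C = 0"
    have br_lin: "a * br A X + 2 * b * br B X + c * br C X = br (a *\<^sub>R A + (2 * b) *\<^sub>R B + c *\<^sub>R C) X" for X
      by (simp add: br_def inner_add_left algebra_simps)
    have "br (a *\<^sub>R A + (2 * b) *\<^sub>R B + c *\<^sub>R C) X = 0" for X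
      unfolding rel by (simp add: br_def)
    then have z: "a * br A X + 2 * b * br B X + c * br C X = 0" for X
      using br_lin by simp
    have sw: "br B A = - \<gamma>" "br C A = 2 * \<beta>" "br C B = - \<alpha>" "br A A = 0" "br B B = 0" "br C C = 0"
      "br A B = \<gamma>" "br A C = - (2 * \<beta>)" "br B C = \<alpha>"
      unfolding two_\<beta> \<alpha>_def \<gamma>_def br_def by (simp_all add: algebra_simps)
    have "c * \<beta> = b * \<gamma>" "a * \<gamma> = c * \<alpha>" "b * \<alpha> = a * \<beta>"
      using z[of A] z[of B] z[of C] unfolding sw by (simp_all add: algebra_simps)
    then show "\<exists>r. a = r * \<alpha> \<and> b = r * \<beta> \<and> c = r * \<gamma>"
      using \<open>\<alpha> \<noteq> 0 \<or> \<beta> \<noteq> 0 \<or> \<gamma> \<noteq> 0\<close>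
      by (elim disjE; intro exI[of _ "if \<alpha> \<noteq> 0 then a / \<alpha> else if \<beta> \<noteq> 0 then b / \<beta> else c / \<gamma>"])
        (auto simp: field_simps)
  next
    fix x y
    let ?p = "x *\<^sub>R A + y *\<^sub>R B" and ?q = "x *\<^sub>R B + y *\<^sub>R C"
    have form: "\<gamma> * x\<^sup>2 - 2 * \<beta> * x * y + \<alpha> * y\<^sup>2 = br ?p ?q"
      unfolding two_\<beta> \<alpha>_def \<gamma>_def br_def
      by (simp add: inner_add_left algebra_simps power2_eq_square)
    have pq: "?p \<in> ?P" "?q \<in> ?P" using ABC by (auto intro!: span_add span_scale)
    show "(\<exists>\<nu>\<in>?P. \<nu> \<noteq> 0 \<and> ?p \<bullet> \<nu> = 0 \<and> ?q \<bullet> \<nu> = 0) \<longleftrightarrow> \<gamma> * x\<^sup>2 - 2 * \<beta> * x * y + \<alpha> * y\<^sup>2 = 0"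
      unfolding form
    proof
      assume "\<exists>\<nu>\<in>?P. \<nu> \<noteq> 0 \<and> ?p \<bullet> \<nu> = 0 \<and> ?q \<bullet> \<nu> = 0"
      then obtain \<nu> where \<nu>: "\<nu> \<in> ?P" "\<nu> \<noteq> 0" "?p \<bullet> \<nu> = 0" "?q \<bullet> \<nu> = 0" by blast
      define n1 n2 where "n1 = \<nu> \<bullet> b1" and "n2 = \<nu> \<bullet> b2"
      have n: "n1 \<noteq> 0 \<or> n2 \<noteq> 0" using zeroI[OF \<nu>(1)] \<nu>(2) by (auto simp: n1_def n2_def)
      have "X \<bullet> \<nu> = (X \<bullet> b1) * n1 + (X \<bullet> b2) * n2" for X
        by (subst expand[OF \<nu>(1)]) (simp add: inner_add_right n1_def n2_def)
      then have e: "(?p \<bullet> b1) * n1 + (?p \<bullet> b2) * n2 = 0" "(?q \<bullet> b1) * n1 + (?q \<bullet> b2) * n2 = 0"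
        using \<nu>(3,4) by metis+
      have "br ?p ?q * n1 = 0" "br ?p ?q * n2 = 0"
        using e unfolding br_def by algebra+
      then show "br ?p ?q = 0" using n by auto
    next
      assume br0: "br ?p ?q = 0"
      have perp: "\<exists>\<nu>\<in>?P. \<nu> \<noteq> 0 \<and> ?p \<bullet> \<nu> = 0 \<and> ?q \<bullet> \<nu> = 0"
        if X: "X \<in> ?P" "X \<noteq> 0" "br X ?p = 0" "br X ?q = 0" for X
      proof (intro bexI conjI)
        let ?\<nu> = "(X \<bullet> b1) *\<^sub>R b2 - (X \<bullet> b2) *\<^sub>R b1"
        show "?p \<bullet> ?\<nu> = 0" "?q \<bullet> ?\<nu> = 0"
          using X(3,4) unfolding br_def by (simp_all only: inner_diff_right inner_scaleR_right)
        show "?\<nu> \<in> ?P" using bP by (intro span_diff span_scale)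
        show "?\<nu> \<noteq> 0"
        proof
          assume "?\<nu> = 0"
          then have "?\<nu> \<bullet> b1 = 0" "?\<nu> \<bullet> b2 = 0" by simp_all
          then have "X \<bullet> b1 = 0" "X \<bullet> b2 = 0" using b12 by (simp_all add: inner_diff_left)
          then show False using zeroI X by blast
        qed
      qed
      consider "?p \<noteq> 0" | "?q \<noteq> 0" | "?p = 0" "?q = 0" by blast
      then show "\<exists>\<nu>\<in>?P. \<nu> \<noteq> 0 \<and> ?p \<bullet> \<nu> = 0 \<and> ?q \<bullet> \<nu> = 0"
      proof cases
        case 1
        then show ?thesis using perp[OF pq(1)] br0 by (simp add: br_def)
      next
        case 2
        have alt: "br X X = 0" "br X Y = - br Y X" for X Y by (simp_all add: br_def)
        have "br ?q ?p = 0" using br0 alt(2)[of ?q ?p] by (simp only: minus_zero)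
        moreover have "br ?q ?q = 0" by (rule alt(1))
        ultimately show ?thesis using perp[OF pq(2) 2] by blast
      next
        case 3
        have "b1 \<noteq> 0" using b12 by auto
        then show ?thesis using 3 bP by (intro bexI[of _ b1]) (simp only: inner_zero_left simp_thms)
      qed
    qed
  qed
qed

text \<open>
  Quadratic formula. The two linear factors are proportional exactly for discriminant zero.
\<close>

lemma binary_form_factors:
  fixes \<alpha> \<beta> \<gamma> :: real
  assumes nz: "\<alpha> \<noteq> 0 \<or> \<beta> \<noteq> 0 \<or> \<gamma> \<noteq> 0" and D: "\<beta>\<^sup>2 - \<alpha> * \<gamma> \<ge> 0"
  obtains c x1 y1 x2 y2 where "c \<noteq> 0" "x1 \<noteq> 0 \<or> y1 \<noteq> 0" "x2 \<noteq> 0 \<or> y2 \<noteq> 0"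
    "\<And>x y. \<gamma> * x\<^sup>2 - 2 * \<beta> * x * y + \<alpha> * y\<^sup>2 = c * (x * y1 - y * x1) * (x * y2 - y * x2)"
    "x1 * y2 = x2 * y1 \<longleftrightarrow> \<beta>\<^sup>2 - \<alpha> * \<gamma> = 0"
proof (cases "\<gamma> = 0")
  case True
  have "\<alpha> \<noteq> 0 \<or> 2 * \<beta> \<noteq> 0" using nz True by auto
  then show ?thesis
    by (intro that[of 1 1 0 \<alpha> "2 * \<beta>"]) (auto simp: True algebra_simps power2_eq_square)
next
  case False
  define s where "s = sqrt (\<beta>\<^sup>2 - \<alpha> * \<gamma>)"
  have s: "s\<^sup>2 = \<beta>\<^sup>2 - \<alpha> * \<gamma>" using D by (simp add: s_def)
  show ?thesis
  proof (rule that[of "1 / \<gamma>" "\<beta> + s" \<gamma> "\<beta> - s" \<gamma>])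
    fix x y
    have "(x * \<gamma> - y * (\<beta> + s)) * (x * \<gamma> - y * (\<beta> - s)) = \<gamma> * (\<gamma> * x\<^sup>2 - 2 * \<beta> * x * y) + (\<beta>\<^sup>2 - s\<^sup>2) * y\<^sup>2"
      by (simp add: algebra_simps power2_eq_square)
    also have "\<dots> = \<gamma> * (\<gamma> * x\<^sup>2 - 2 * \<beta> * x * y + \<alpha> * y\<^sup>2)"
      by (simp add: s algebra_simps)
    finally show "\<gamma> * x\<^sup>2 - 2 * \<beta> * x * y + \<alpha> * y\<^sup>2
        = 1 / \<gamma> * (x * \<gamma> - y * (\<beta> + s)) * (x * \<gamma> - y * (\<beta> - s))"
      using False by (simp add: field_simps)
    have "(\<beta> + s) * \<gamma> = (\<beta> - s) * \<gamma> \<longleftrightarrow> s = 0" using False by auto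
    then show "(\<beta> + s) * \<gamma> = (\<beta> - s) * \<gamma> \<longleftrightarrow> \<beta>\<^sup>2 - \<alpha> * \<gamma> = 0" using s by auto
  qed (use False in auto)
qed

lemma card_lines_binary_form:
  fixes e1 e2 :: "'a::real_vector" and \<alpha> \<beta> \<gamma> :: real
  assumes indep: "\<And>x y. x *\<^sub>R e1 + y *\<^sub>R e2 = 0 \<Longrightarrow> x = 0 \<and> y = 0"
    and nz: "\<alpha> \<noteq> 0 \<or> \<beta> \<noteq> 0 \<or> \<gamma> \<noteq> 0"
  defines "L \<equiv> {span {x *\<^sub>R e1 + y *\<^sub>R e2} | x y. (x \<noteq> 0 \<or> y \<noteq> 0) \<and>
    \<gamma> * x\<^sup>2 - 2 * \<beta> * x * y + \<alpha> * y\<^sup>2 = 0}"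
  shows "\<beta>\<^sup>2 - \<alpha> * \<gamma> > 0 \<Longrightarrow> card L = 2"
    and "\<beta>\<^sup>2 - \<alpha> * \<gamma> = 0 \<Longrightarrow> card L = 1"
    and "\<beta>\<^sup>2 - \<alpha> * \<gamma> < 0 \<Longrightarrow> L = {}"
proof -
  have coeff: "x = x' \<and> y = y'" if "x *\<^sub>R e1 + y *\<^sub>R e2 = x' *\<^sub>R e1 + y' *\<^sub>R e2" for x y x' y'
    using indep[of "x - x'" "y - y'"] that by (simp add: algebra_simps)
  have line_eq: "span {x *\<^sub>R e1 + y *\<^sub>R e2} = span {x' *\<^sub>R e1 + y' *\<^sub>R e2} \<longleftrightarrow> x * y' - y * x' = 0"
    if "x \<noteq> 0 \<or> y \<noteq> 0" and nz': "x' \<noteq> 0 \<or> y' \<noteq> 0" for x y x' y'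
  proof
    assume "span {x *\<^sub>R e1 + y *\<^sub>R e2} = span {x' *\<^sub>R e1 + y' *\<^sub>R e2}"
    then have "x *\<^sub>R e1 + y *\<^sub>R e2 \<in> span {x' *\<^sub>R e1 + y' *\<^sub>R e2}" using span_base by blast
    then obtain r where "x *\<^sub>R e1 + y *\<^sub>R e2 = r *\<^sub>R (x' *\<^sub>R e1 + y' *\<^sub>R e2)"
      by (auto simp: span_singleton)
    then have "x = r * x' \<and> y = r * y'" by (intro coeff) (simp add: algebra_simps)
    then show "x * y' - y * x' = 0" by simp
  next
    assume p: "x * y' - y * x' = 0"
    define r where "r = (if x' \<noteq> 0 then x / x' else y / y')"
    have r: "x = r * x'" "y = r * y'" using p nz' by (auto simp: r_def field_simps)
    then have "r \<noteq> 0" using that(1) by auto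
    have "x *\<^sub>R e1 + y *\<^sub>R e2 = r *\<^sub>R (x' *\<^sub>R e1 + y' *\<^sub>R e2)"
      unfolding r by (simp add: algebra_simps)
    then show "span {x *\<^sub>R e1 + y *\<^sub>R e2} = span {x' *\<^sub>R e1 + y' *\<^sub>R e2}"
      using span_image_scale[of "{x' *\<^sub>R e1 + y' *\<^sub>R e2}" "\<lambda>_. r"] \<open>r \<noteq> 0\<close> by simp
  qed
  \<comment> \<open>Each linear factor contributes the line of its zeros.\<close>
  have L2: "\<exists>l1 l2. L = {l1, l2} \<and> (l1 = l2 \<longleftrightarrow> \<beta>\<^sup>2 - \<alpha> * \<gamma> = 0)" if D: "\<beta>\<^sup>2 - \<alpha> * \<gamma> \<ge> 0"
  proof -
    obtain c x1 y1 x2 y2 where *: "c \<noteq> 0" "x1 \<noteq> 0 \<or> y1 \<noteq> 0" "x2 \<noteq> 0 \<or> y2 \<noteq> 0"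
      "\<And>x y. \<gamma> * x\<^sup>2 - 2 * \<beta> * x * y + \<alpha> * y\<^sup>2 = c * (x * y1 - y * x1) * (x * y2 - y * x2)"
      "x1 * y2 = x2 * y1 \<longleftrightarrow> \<beta>\<^sup>2 - \<alpha> * \<gamma> = 0"
      using binary_form_factors[OF nz D] by blast
    let ?l = "\<lambda>x y. span {x *\<^sub>R e1 + y *\<^sub>R e2}"
    have "\<gamma> * x\<^sup>2 - 2 * \<beta> * x * y + \<alpha> * y\<^sup>2 = 0 \<longleftrightarrow> ?l x y = ?l x1 y1 \<or> ?l x y = ?l x2 y2"
      if "x \<noteq> 0 \<or> y \<noteq> 0" for x y
      unfolding *(4) line_eq[OF that *(2)] line_eq[OF that *(3)] using *(1) by simp
    then have "L = {?l x y | x y. (x \<noteq> 0 \<or> y \<noteq> 0) \<and> (?l x y = ?l x1 y1 \<or> ?l x y = ?l x2 y2)}"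
      unfolding L_def by (intro Collect_cong) metis
    also have "\<dots> = {?l x1 y1, ?l x2 y2}" using *(2,3) by auto
    finally have "L = {?l x1 y1, ?l x2 y2}" .
    moreover have "?l x1 y1 = ?l x2 y2 \<longleftrightarrow> \<beta>\<^sup>2 - \<alpha> * \<gamma> = 0"
      unfolding line_eq[OF *(2,3)] *(5)[symmetric] by (auto simp: mult.commute)
    ultimately show ?thesis by blast
  qed
  show "card L = 2" if D: "\<beta>\<^sup>2 - \<alpha> * \<gamma> > 0"
  proof -
    from D have "\<beta>\<^sup>2 - \<alpha> * \<gamma> \<ge> 0" "\<beta>\<^sup>2 - \<alpha> * \<gamma> \<noteq> 0" by auto
    then obtain l1 l2 where "L = {l1, l2}" "l1 \<noteq> l2" using L2 by metis
    then show ?thesis by simp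
  qed
  show "card L = 1" if D: "\<beta>\<^sup>2 - \<alpha> * \<gamma> = 0"
  proof -
    obtain l1 l2 where "L = {l1, l2}" "l1 = l2" using L2 D by (metis order_refl)
    then show ?thesis by simp
  qed
  show "L = {}" if D: "\<beta>\<^sup>2 - \<alpha> * \<gamma> < 0"
  proof -
    have "x = 0 \<and> y = 0" if q: "\<gamma> * x\<^sup>2 - 2 * \<beta> * x * y + \<alpha> * y\<^sup>2 = 0" for x y
    proof -
      have "(\<gamma> * x - \<beta> * y)\<^sup>2 + (\<alpha> * \<gamma> - \<beta>\<^sup>2) * y\<^sup>2 = \<gamma> * (\<gamma> * x\<^sup>2 - 2 * \<beta> * x * y + \<alpha> * y\<^sup>2)"
        by (simp add: power2_eq_square algebra_simps)
      then have sum0: "(\<gamma> * x - \<beta> * y)\<^sup>2 + (\<alpha> * \<gamma> - \<beta>\<^sup>2) * y\<^sup>2 = 0" using q by simp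
      have pos: "\<alpha> * \<gamma> - \<beta>\<^sup>2 > 0" using D by simp
      have "(\<alpha> * \<gamma> - \<beta>\<^sup>2) * y\<^sup>2 \<ge> 0" using pos by simp
      then have "(\<gamma> * x - \<beta> * y)\<^sup>2 = 0" "(\<alpha> * \<gamma> - \<beta>\<^sup>2) * y\<^sup>2 = 0"
        using sum0 zero_le_power2[of "\<gamma> * x - \<beta> * y"] by linarith+
      then have "y = 0" "\<gamma> * x = 0" using pos by auto
      moreover have "\<gamma> \<noteq> 0" using pos by (auto simp: not_less)
      ultimately show ?thesis by simp
    qed
    then show ?thesis unfolding L_def by blast
  qed
qed

text \<open>
  The hull lies in the convex set of the \<open>a A + 2b B + c C\<close> with positive semidefinite \<open>(a, b; b, c)\<close> of
  trace 1. A representation of \<open>0\<close> is a multiple of \<open>(\<alpha>, \<beta>, \<gamma>)\<close>, which is indefinite for positive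
  discriminant. If the discriminant is zero, \<open>(\<alpha>, \<beta>, \<gamma>)\<close> is proportional to \<open>(x\<^sup>2, x y, y\<^sup>2)\<close>. If it
  is negative, completing the square in a multiple of the relation writes \<open>0\<close> as a positive
  combination of two points of the ellipse.
\<close>

lemma zero_in_ellipse_hull:
  fixes A B C :: "'a::real_vector"
  assumes nz: "\<alpha> \<noteq> 0 \<or> \<beta> \<noteq> 0 \<or> \<gamma> \<noteq> 0"
    and rel: "\<alpha> *\<^sub>R A + (2 * \<beta>) *\<^sub>R B + \<gamma> *\<^sub>R C = 0"
    and uniq: "\<And>a b c. a *\<^sub>R A + (2 * b) *\<^sub>R B + c *\<^sub>R C = 0 \<Longrightarrow>
      \<exists>r. a = r * \<alpha> \<and> b = r * \<beta> \<and> c = r * \<gamma>"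
  defines "ell \<equiv> {x\<^sup>2 *\<^sub>R A + (2 * (x * y)) *\<^sub>R B + y\<^sup>2 *\<^sub>R C | x y. x\<^sup>2 + y\<^sup>2 = 1}"
  shows "\<beta>\<^sup>2 - \<alpha> * \<gamma> > 0 \<Longrightarrow> 0 \<notin> convex hull ell"
    and "\<beta>\<^sup>2 - \<alpha> * \<gamma> = 0 \<Longrightarrow> 0 \<in> ell"
    and "\<beta>\<^sup>2 - \<alpha> * \<gamma> < 0 \<Longrightarrow> 0 \<in> convex hull ell \<and> 0 \<notin> ell"
proof -
  assume D: "\<beta>\<^sup>2 - \<alpha> * \<gamma> > 0"
  let ?K = "{a *\<^sub>R A + (2 * b) *\<^sub>R B + c *\<^sub>R C | a b c.
      (\<forall>s t. a * s\<^sup>2 + 2 * b * (s * t) + c * t\<^sup>2 \<ge> 0) \<and> a + c = 1}"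
  have "convex ?K"
  proof (rule convexI)
    fix p q u v assume "p \<in> ?K" "q \<in> ?K" and uv: "0 \<le> u" "0 \<le> v" "u + v = (1::real)"
    then obtain a b c a' b' c' where p: "p = a *\<^sub>R A + (2 * b) *\<^sub>R B + c *\<^sub>R C"
        "\<And>s t. a * s\<^sup>2 + 2 * b * (s * t) + c * t\<^sup>2 \<ge> 0" "a + c = 1"
      and q: "q = a' *\<^sub>R A + (2 * b') *\<^sub>R B + c' *\<^sub>R C"
        "\<And>s t. a' * s\<^sup>2 + 2 * b' * (s * t) + c' * t\<^sup>2 \<ge> 0" "a' + c' = 1" by blast
    have "u *\<^sub>R p + v *\<^sub>R q = (u * a + v * a') *\<^sub>R A + (2 * (u * b + v * b')) *\<^sub>R B + (u * c + v * c') *\<^sub>R C"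
      unfolding p(1) q(1) by (simp add: algebra_simps)
    moreover have "(u * a + v * a') * s\<^sup>2 + 2 * (u * b + v * b') * (s * t) + (u * c + v * c') * t\<^sup>2 \<ge> 0" for s t
    proof -
      have "0 \<le> u * (a * s\<^sup>2 + 2 * b * (s * t) + c * t\<^sup>2) + v * (a' * s\<^sup>2 + 2 * b' * (s * t) + c' * t\<^sup>2)"
        by (rule add_nonneg_nonneg[OF mult_nonneg_nonneg[OF uv(1) p(2)] mult_nonneg_nonneg[OF uv(2) q(2)]])
      then show ?thesis by (simp add: algebra_simps)
    qed
    moreover have "(u * a + v * a') + (u * c + v * c') = 1"
    proof -
      have "(u * a + v * a') + (u * c + v * c') = u * (a + c) + v * (a' + c')" by (simp add: algebra_simps)
      then show ?thesis using p(3) q(3) uv by simp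
    qed
    ultimately show "u *\<^sub>R p + v *\<^sub>R q \<in> ?K" by blast
  qed
  moreover have "ell \<subseteq> ?K"
  proof
    fix p assume "p \<in> ell"
    then obtain x y where xy: "p = x\<^sup>2 *\<^sub>R A + (2 * (x * y)) *\<^sub>R B + y\<^sup>2 *\<^sub>R C" "x\<^sup>2 + y\<^sup>2 = 1"
      unfolding ell_def by blast
    have "x\<^sup>2 * s\<^sup>2 + 2 * (x * y) * (s * t) + y\<^sup>2 * t\<^sup>2 = (x * s + y * t)\<^sup>2" for s t
      by (simp add: power2_eq_square algebra_simps)
    then have "\<forall>s t. x\<^sup>2 * s\<^sup>2 + 2 * (x * y) * (s * t) + y\<^sup>2 * t\<^sup>2 \<ge> 0" by simp
    then show "p \<in> ?K" using xy by blast
  qed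
  ultimately have hull: "convex hull ell \<subseteq> ?K" by (simp add: hull_minimal)
  show "0 \<notin> convex hull ell"
  proof
    assume "0 \<in> convex hull ell"
    then have "0 \<in> ?K" using hull by blast
    then obtain a b c where abc: "a *\<^sub>R A + (2 * b) *\<^sub>R B + c *\<^sub>R C = 0"
      "\<And>s t. a * s\<^sup>2 + 2 * b * (s * t) + c * t\<^sup>2 \<ge> 0" "a + c = 1" by (auto dest: sym)
    obtain r where r: "a = r * \<alpha>" "b = r * \<beta>" "c = r * \<gamma>" using uniq[OF abc(1)] by blast
    have "r \<noteq> 0" using abc(3) r by auto
    have "a \<ge> 0" "c \<ge> 0" using abc(2)[of 1 0] abc(2)[of 0 1] by simp_all
    have disc: "b\<^sup>2 - a * c = r\<^sup>2 * (\<beta>\<^sup>2 - \<alpha> * \<gamma>)"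
      unfolding r by (simp add: power2_eq_square algebra_simps)
    then have pos: "b\<^sup>2 - a * c > 0" using D \<open>r \<noteq> 0\<close> by simp
    have "a * b\<^sup>2 - 2 * b * (b * a) + c * a\<^sup>2 = - (a * (b\<^sup>2 - a * c))"
      by (simp add: power2_eq_square algebra_simps)
    \<comment> \<open>At \<open>(-b, a)\<close> and \<open>(c, -b)\<close> the form takes the values \<open>a\<close> and \<open>c\<close> times its determinant.\<close>
    then have "a * (b\<^sup>2 - a * c) \<le> 0" using abc(2)[of "-b" a] by simp
    then have "a = 0" using pos \<open>a \<ge> 0\<close> by (simp add: mult_le_0_iff)
    have "a * c\<^sup>2 - 2 * b * (c * b) + c * b\<^sup>2 = - (c * (b\<^sup>2 - a * c))"
      by (simp add: power2_eq_square algebra_simps)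
    then have "c * (b\<^sup>2 - a * c) \<le> 0" using abc(2)[of c "-b"] by simp
    then have "c = 0" using pos \<open>c \<ge> 0\<close> by (simp add: mult_le_0_iff)
    then show False using \<open>a = 0\<close> abc(3) by simp
  qed
next
  assume D: "\<beta>\<^sup>2 - \<alpha> * \<gamma> = 0"
  have key: "0 \<in> ell" if xy: "x \<noteq> 0 \<or> y \<noteq> 0" and z: "x\<^sup>2 *\<^sub>R A + (2 * (x * y)) *\<^sub>R B + y\<^sup>2 *\<^sub>R C = 0" for x y
  proof -
    define n where "n = x\<^sup>2 + y\<^sup>2"
    have n: "n > 0" using xy by (auto simp: n_def sum_power2_gt_zero_iff)
    define x' y' where "x' = x / sqrt n" and "y' = y / sqrt n"
    have "x'\<^sup>2 = x\<^sup>2 / n" "y'\<^sup>2 = y\<^sup>2 / n" "x' * y' = x * y / n"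
      using n by (simp_all add: x'_def y'_def power_divide)
    then have "x'\<^sup>2 *\<^sub>R A + (2 * (x' * y')) *\<^sub>R B + y'\<^sup>2 *\<^sub>R C
        = (1 / n) *\<^sub>R (x\<^sup>2 *\<^sub>R A + (2 * (x * y)) *\<^sub>R B + y\<^sup>2 *\<^sub>R C)"
      by (simp add: algebra_simps)
    moreover have "x'\<^sup>2 + y'\<^sup>2 = n / n"
      unfolding \<open>x'\<^sup>2 = _\<close> \<open>y'\<^sup>2 = _\<close> unfolding n_def by (rule add_divide_distrib[symmetric])
    then have "x'\<^sup>2 + y'\<^sup>2 = 1" using n by simp
    ultimately have "0 = x'\<^sup>2 *\<^sub>R A + (2 * (x' * y')) *\<^sub>R B + y'\<^sup>2 *\<^sub>R C \<and> x'\<^sup>2 + y'\<^sup>2 = 1"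
      using z by simp
    then show ?thesis unfolding ell_def by blast
  qed
  show "0 \<in> ell"
  proof (cases "\<alpha> = 0")
    case True
    then have "\<beta> = 0" "\<gamma> \<noteq> 0" using D nz by auto
    then have "C = 0" using rel True by simp
    then show ?thesis using key[of 0 1] by simp
  next
    case False
    have "\<alpha>\<^sup>2 *\<^sub>R A + (2 * (\<alpha> * \<beta>)) *\<^sub>R B + \<beta>\<^sup>2 *\<^sub>R C = \<alpha> *\<^sub>R (\<alpha> *\<^sub>R A + (2 * \<beta>) *\<^sub>R B + \<gamma> *\<^sub>R C)"
      using D by (simp add: algebra_simps power2_eq_square)
    then show ?thesis using key[of \<alpha> \<beta>] False rel by simp
  qed
next
  assume D: "\<beta>\<^sup>2 - \<alpha> * \<gamma> < 0"
  have "0 \<notin> ell"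
  proof
    assume "0 \<in> ell"
    then obtain x y where xy: "x\<^sup>2 *\<^sub>R A + (2 * (x * y)) *\<^sub>R B + y\<^sup>2 *\<^sub>R C = 0" "x\<^sup>2 + y\<^sup>2 = 1"
      unfolding ell_def by (auto dest: sym)
    obtain r where r: "x\<^sup>2 = r * \<alpha>" "x * y = r * \<beta>" "y\<^sup>2 = r * \<gamma>" using uniq[OF xy(1)] by blast
    have "r \<noteq> 0" using r xy(2) by auto
    have "r\<^sup>2 * (\<beta>\<^sup>2 - \<alpha> * \<gamma>) = (x * y)\<^sup>2 - x\<^sup>2 * y\<^sup>2"
      unfolding r by (simp add: power2_eq_square algebra_simps)
    then have "r\<^sup>2 * (\<beta>\<^sup>2 - \<alpha> * \<gamma>) = 0" by (simp add: power_mult_distrib)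
    then show False using \<open>r \<noteq> 0\<close> D by simp
  qed
  moreover have "0 \<in> convex hull ell"
  proof -
    have "\<alpha> \<noteq> 0" using D by (auto simp: not_less)
    define n where "n = \<alpha>\<^sup>2 + \<beta>\<^sup>2"
    have n: "n > 0" using \<open>\<alpha> \<noteq> 0\<close> by (auto simp: n_def sum_power2_gt_zero_iff)
    define x y where "x = \<alpha> / sqrt n" and "y = \<beta> / sqrt n"
    have sq: "x\<^sup>2 = \<alpha>\<^sup>2 / n" "y\<^sup>2 = \<beta>\<^sup>2 / n" "x * y = \<alpha> * \<beta> / n"
      using n by (simp_all add: x_def y_def power_divide)
    define p where "p = x\<^sup>2 *\<^sub>R A + (2 * (x * y)) *\<^sub>R B + y\<^sup>2 *\<^sub>R C"
    have "x\<^sup>2 + y\<^sup>2 = n / n" unfolding sq n_def by (rule add_divide_distrib[symmetric])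
    then have "x\<^sup>2 + y\<^sup>2 = 1" using n by simp
    then have pE: "p \<in> ell" unfolding p_def ell_def by blast
    have "C = 0\<^sup>2 *\<^sub>R A + (2 * (0 * 1)) *\<^sub>R B + 1\<^sup>2 *\<^sub>R C" by simp
    then have CE: "C \<in> ell" unfolding ell_def by (metis (mono_tags, lifting) mem_Collect_eq power_zero_numeral add_0 one_power2)
    have np: "n *\<^sub>R p = \<alpha>\<^sup>2 *\<^sub>R A + (2 * (\<alpha> * \<beta>)) *\<^sub>R B + \<beta>\<^sup>2 *\<^sub>R C"
      unfolding p_def sq using n by (simp add: scaleR_add_right)
    \<comment> \<open>Completing the square in \<open>\<alpha>\<close> times the relation leaves \<open>m C\<close>; both weights \<open>n\<close> and \<open>m\<close> are positive.\<close>
    define m where "m = \<alpha> * \<gamma> - \<beta>\<^sup>2"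
    have m: "m > 0" using D by (simp add: m_def)
    have "n *\<^sub>R p + m *\<^sub>R C = \<alpha> *\<^sub>R (\<alpha> *\<^sub>R A + (2 * \<beta>) *\<^sub>R B + \<gamma> *\<^sub>R C)"
      unfolding np m_def by (simp add: algebra_simps power2_eq_square)
    then have comb: "n *\<^sub>R p + m *\<^sub>R C = 0" using rel by simp
    have "(n / (n + m)) *\<^sub>R p + (m / (n + m)) *\<^sub>R C \<in> convex hull ell"
      using pE CE n m by (intro convexD[OF convex_convex_hull] hull_inc)
        (auto simp flip: add_divide_distrib)
    moreover have "(n / (n + m)) *\<^sub>R p + (m / (n + m)) *\<^sub>R C = (1 / (n + m)) *\<^sub>R (n *\<^sub>R p + m *\<^sub>R C)"
      by (simp add: scaleR_add_right)
    ultimately show ?thesis using comb by simp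
  qed
  ultimately show "0 \<in> convex hull ell \<and> 0 \<notin> ell" by simp
qed

section \<open>Subspaces of dimension two\<close>

text \<open>
  The description in \<open>orth_proj\<close> is meaningful on a subspace, where the foot of the perpendicular exists
  and is unique.
\<close>

lemma orth_proj_subspace:
  fixes S :: "(real^5) set"
  assumes "subspace S"
  shows "orth_proj S x \<in> S" "z \<in> S \<Longrightarrow> orth_proj S x \<bullet> z = x \<bullet> z"
proof -
  obtain y w where yw: "y \<in> span S" "\<And>z. z \<in> span S \<Longrightarrow> orthogonal w z" "x = y + w"
    using orthogonal_subspace_decomp_exists[of S x] by metis
  have sp: "span S = S" using assms by simp
  have ex: "y \<in> S \<and> (\<forall>z\<in>S. orthogonal (x - y) z)" using yw sp by auto
  have uniq: "y' = y" if y': "y' \<in> S \<and> (\<forall>z\<in>S. orthogonal (x - y') z)" for y'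
  proof -
    have "y' - y \<in> S" using ex y' assms subspace_diff by blast
    then have "orthogonal (x - y) (y' - y)" "orthogonal (x - y') (y' - y)" using ex y' by auto
    then have "(y' - y) \<bullet> (y' - y) = 0" by (simp add: orthogonal_def inner_diff_left)
    then show "y' = y" by simp
  qed
  have "\<exists>!y. y \<in> S \<and> (\<forall>z\<in>S. orthogonal (x - y) z)" using ex uniq by blast
  then have "orth_proj S x \<in> S \<and> (\<forall>z\<in>S. orthogonal (x - orth_proj S x) z)"
    unfolding orth_proj_def by (rule theI')
  then show "orth_proj S x \<in> S" "z \<in> S \<Longrightarrow> orth_proj S x \<bullet> z = x \<bullet> z"
    by (auto simp: orthogonal_def inner_diff_left)
qed

lemma subspace_eq_by_inner:
  fixes x y :: "'a::real_inner"
  assumes "subspace S" "x \<in> S" "y \<in> S" "\<And>z. z \<in> S \<Longrightarrow> x \<bullet> z = y \<bullet> z"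
  shows "x = y"
proof -
  have "(x - y) \<bullet> (x - y) = 0"
    using assms(4)[OF subspace_diff[OF assms(1-3)]] by (simp add: inner_diff_left)
  then show ?thesis by simp
qed

lemma span_pairE:
  assumes "x \<in> span {b, c}"
  obtains s t where "x = s *\<^sub>R b + t *\<^sub>R c"
proof -
  obtain s where "x - s *\<^sub>R b \<in> span {c}" using assms span_breakdown_eq[of x b] by blast
  then obtain t where "x - s *\<^sub>R b = t *\<^sub>R c" by (auto simp: span_singleton)
  then have "x = s *\<^sub>R b + t *\<^sub>R c" by (metis add.commute diff_add_cancel)
  then show ?thesis by (rule that)
qed

lemma subspace_dim2_eq_span:
  fixes S :: "'a::euclidean_space set"
  assumes "subspace S" "dim S = 2" "b \<in> S" "c \<in> S" "b \<noteq> c" "independent {b, c}"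
  shows "S = span {b, c}"
proof
  show "S \<subseteq> span {b, c}" using assms by (intro card_ge_dim_independent) auto
  show "span {b, c} \<subseteq> S" using assms by (intro span_minimal) auto
qed

text \<open>
  The points with parameters \<open>0\<close>, \<open>1\<close> and \<open>-1\<close> of a nondegenerate parabola are affinely independent.
\<close>

lemma affine_hull_nondegenerate_parabola:
  assumes "nondegenerate_parabola S" "S \<subseteq> P" "subspace P" "dim P = 2"
  shows "affine hull S = P"
proof
  show "affine hull S \<subseteq> P" using assms by (intro hull_minimal subspace_imp_affine)
  obtain a b c where abc: "b \<noteq> c" "independent {b, c}" and S: "S = range (\<lambda>t::real. a + t *\<^sub>R b + t\<^sup>2 *\<^sub>R c)"
    using assms(1) unfolding nondegenerate_parabola_def by blast
  have pts: "a + t *\<^sub>R b + t\<^sup>2 *\<^sub>R c \<in> S" for t unfolding S by blast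
  have inS: "a \<in> S" "a + b + c \<in> S" "a - b + c \<in> S"
    using pts[of 0] pts[of 1] pts[of "-1"] by simp_all
  then have inP: "a \<in> P" "a + b + c \<in> P" "a - b + c \<in> P" using assms(2) by auto
  have "(1/2) *\<^sub>R ((a + b + c) - (a - b + c)) \<in> P"
    by (intro subspace_scale subspace_diff inP assms(3))
  moreover have "(a + b + c) - (a - b + c) = 2 *\<^sub>R b" by (simp add: scaleR_2)
  ultimately have bP: "b \<in> P" by simp
  have "(a + b + c) - a - b \<in> P" by (intro subspace_diff inP bP assms(3))
  then have cP: "c \<in> P" by simp
  show "P \<subseteq> affine hull S"
  proof
    fix x assume "x \<in> P"
    then have "x - a \<in> span {b, c}"
      using subspace_dim2_eq_span[OF assms(3,4) bP cP abc] inP assms(3) subspace_diff by blast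
    then obtain s t where "x - a = s *\<^sub>R b + t *\<^sub>R c"
      by (rule span_pairE)
    then have "x = a + s *\<^sub>R b + t *\<^sub>R c" by (simp add: algebra_simps)
    also have "\<dots> = (1 - t) *\<^sub>R a + ((t + s) / 2) *\<^sub>R (a + b + c) + ((t - s) / 2) *\<^sub>R (a - b + c)"
    proof -
      have "(t + s) / 2 + (t - s) / 2 = t" "(t + s) / 2 - (t - s) / 2 = s" by (simp_all add: field_simps)
      moreover have "(1 - t) *\<^sub>R a + ((t + s) / 2) *\<^sub>R (a + b + c) + ((t - s) / 2) *\<^sub>R (a - b + c)
        = (1 - t + ((t + s) / 2 + (t - s) / 2)) *\<^sub>R a + ((t + s) / 2 - (t - s) / 2) *\<^sub>R b
          + ((t + s) / 2 + (t - s) / 2) *\<^sub>R c"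
        by (simp only: scaleR_add_left scaleR_diff_left scaleR_add_right scaleR_diff_right) simp
      ultimately show ?thesis by simp
    qed
    also have "\<dots> \<in> affine hull {a, a + b + c, a - b + c}"
    proof -
      have "(1 - t) + (t + s) / 2 + (t - s) / 2 = 1" by (simp add: field_simps)
      then show ?thesis unfolding affine_hull_3 by blast
    qed
    also have "\<dots> \<subseteq> affine hull S" using inS by (intro hull_mono) auto
    finally show "x \<in> affine hull S" .
  qed
qed

section \<open>The second fundamental form of a surface\<close>

lemma linear_proj_along: "linear (proj_along u)"
  unfolding proj_along_def by (intro linearI) (simp_all add: inner_add_left algebra_simps)

lemma linear_inner_right_arg: "linear (\<lambda>y. y \<bullet> \<nu>)" for \<nu> :: "'a::real_inner"
  by (simp add: bounded_linear.linear bounded_linear_inner_left)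

text \<open>
  By polarization this is the linear span of the curvature ellipse.
\<close>

definition II_span :: "(real^5) set \<Rightarrow> real^5 \<Rightarrow> (real^5) set" where
  "II_span M p = span {II M p v w | v w. v \<in> tangent_space M p \<and> w \<in> tangent_space M p}"

locale surface_point =
  fixes M :: "(real^5) set" and p :: "real^5"
  assumes regular: "regular_surface M" and on_surface: "p \<in> M"
begin

abbreviation "\<phi> \<equiv> chart M p"
abbreviation "J \<equiv> (\<lambda>x. ddir x (chart M p) 0)"
abbreviation "T \<equiv> tangent_space M p"
abbreviation "N \<equiv> normal_space M p"
abbreviation "P \<equiv> II_span M p"

lemma chart_smooth: "\<exists>U. open U \<and> 0 \<in> U \<and> smooth_on U \<phi> \<and> inj J"
proof -
  have "local_param M p \<phi>"
    unfolding chart_def using regular on_surface regular_surface_def by (metis someI_ex)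
  then show ?thesis unfolding local_param_def ddir_def by blast
qed

lemma linear_J: "linear J"
  using chart_smooth linear_ddir by blast

lemma T_eq_range: "T = range J"
  by (simp add: tangent_space_def ddir_def)

lemma coord_J: "coord M p (J x) = x"
  using chart_smooth unfolding coord_def ddir_def by (metis inv_f_f)

lemma J_coord: "v \<in> T \<Longrightarrow> J (coord M p v) = v"
  unfolding T_eq_range using coord_J by auto

lemma coord_combo: "v \<in> T \<Longrightarrow> w \<in> T \<Longrightarrow>
    coord M p (x *\<^sub>R v + y *\<^sub>R w) = x *\<^sub>R coord M p v + y *\<^sub>R coord M p w"
  using coord_J[of "x *\<^sub>R coord M p v + y *\<^sub>R coord M p w"]
  by (simp add: linear_add[OF linear_J] linear_cmul[OF linear_J] J_coord)

lemma subspace_T: "subspace T"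
  unfolding T_eq_range using linear_J by (simp add: linear_subspace_image)

lemma dim_T: "dim T = 2"
  unfolding T_eq_range using dim_image_eq[of J UNIV] linear_J chart_smooth by (auto simp: inj_on_def)

lemma subspace_N: "subspace N"
  by (simp add: normal_space_def subspace_orthogonal_comp)

lemma N_perp: "\<nu> \<in> N \<Longrightarrow> v \<in> T \<Longrightarrow> v \<bullet> \<nu> = 0"
  by (simp add: normal_space_def orthogonal_comp_def orthogonal_def)

lemma II_N: "II M p v w \<in> N"
  unfolding II_def by (rule orth_proj_subspace[OF subspace_N])

lemma II_inner: "\<nu> \<in> N \<Longrightarrow> II M p v w \<bullet> \<nu> = D2 \<phi> 0 (coord M p v) (coord M p w) \<bullet> \<nu>"
  unfolding II_def by (rule orth_proj_subspace[OF subspace_N])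

lemma II_commute: "II M p v w = II M p w v"
  unfolding II_def using D2_commute chart_smooth by metis

lemma II_linear:
  assumes "v \<in> T" "w \<in> T"
  shows "II M p (x *\<^sub>R v + y *\<^sub>R w) z = x *\<^sub>R II M p v z + y *\<^sub>R II M p w z"
proof (rule subspace_eq_by_inner[OF subspace_N II_N])
  show "x *\<^sub>R II M p v z + y *\<^sub>R II M p w z \<in> N"
    using II_N subspace_N by (intro subspace_add subspace_scale)
  obtain U where "open U" "0 \<in> U" "smooth_on U \<phi>" using chart_smooth by blast
  then have lin: "linear (\<lambda>a. D2 \<phi> 0 a b)" for b using linear_D2(2) by blast
  fix \<nu> assume \<nu>: "\<nu> \<in> N"
  show "II M p (x *\<^sub>R v + y *\<^sub>R w) z \<bullet> \<nu> = (x *\<^sub>R II M p v z + y *\<^sub>R II M p w z) \<bullet> \<nu>"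
    by (simp add: II_inner[OF \<nu>] inner_add_left coord_combo[OF assms]
        linear_add[OF lin] linear_cmul[OF lin])
qed

lemma II_linear_right:
  assumes "v \<in> T" "w \<in> T"
  shows "II M p z (x *\<^sub>R v + y *\<^sub>R w) = x *\<^sub>R II M p z v + y *\<^sub>R II M p z w"
  using II_linear[OF assms, of x y z] by (simp only: II_commute[of z])

lemma II_scale: "v \<in> T \<Longrightarrow> II M p (x *\<^sub>R v) z = x *\<^sub>R II M p v z"
  using II_linear[of v v x 0 z] by simp

lemma II_quadratic:
  assumes "v \<in> T" "w \<in> T"
  shows "II M p (x *\<^sub>R v + y *\<^sub>R w) (x *\<^sub>R v + y *\<^sub>R w)
    = x\<^sup>2 *\<^sub>R II M p v v + (2 * (x * y)) *\<^sub>R II M p v w + y\<^sup>2 *\<^sub>R II M p w w"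
proof -
  have "(2 * (x * y)) *\<^sub>R II M p v w = (x * y) *\<^sub>R II M p v w + (y * x) *\<^sub>R II M p v w"
    by (simp add: mult.commute flip: scaleR_add_left)
  then show ?thesis
    unfolding II_linear[OF assms] II_linear_right[OF assms] II_commute[of w v]
    by (simp add: scaleR_add_right power2_eq_square)
qed

lemma onb_coeffs:
  assumes "tangent_onb M p e1 e2"
  shows "x *\<^sub>R e1 + y *\<^sub>R e2 = 0 \<Longrightarrow> x = 0 \<and> y = 0"
    and "norm (x *\<^sub>R e1 + y *\<^sub>R e2)^2 = x\<^sup>2 + y\<^sup>2"
    and "x *\<^sub>R e1 + y *\<^sub>R e2 \<in> T"
    and "v \<in> T \<Longrightarrow> \<exists>x y. v = x *\<^sub>R e1 + y *\<^sub>R e2"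
proof -
  have e: "e1 \<in> T" "e2 \<in> T" "e1 \<bullet> e1 = 1" "e2 \<bullet> e2 = 1" "e1 \<bullet> e2 = 0" "e2 \<bullet> e1 = 0"
    using assms by (auto simp: tangent_onb_def orthogonal_def norm_eq_1 inner_commute)
  show nrm: "norm (x *\<^sub>R e1 + y *\<^sub>R e2)^2 = x\<^sup>2 + y\<^sup>2" for x y
    unfolding power2_norm_eq_inner using e by (simp add: inner_add_left inner_add_right power2_eq_square)
  show "x = 0 \<and> y = 0" if "x *\<^sub>R e1 + y *\<^sub>R e2 = 0"
    using nrm[of x y] unfolding that by (simp add: sum_power2_eq_zero_iff)
  show "x *\<^sub>R e1 + y *\<^sub>R e2 \<in> T" using e subspace_T by (intro subspace_add subspace_scale)
  have "e1 \<noteq> e2" using e by auto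
  moreover have "independent {e1, e2}"
    using e by (intro pairwise_orthogonal_independent) (auto simp: pairwise_def orthogonal_def)
  ultimately have "T = span {e1, e2}" using e subspace_T dim_T subspace_dim2_eq_span by blast
  then show "\<exists>x y. v = x *\<^sub>R e1 + y *\<^sub>R e2" if "v \<in> T"
    using that span_pairE by metis
qed

lemma II_span_onb:
  assumes onb: "tangent_onb M p e1 e2"
  shows "P = span {II M p e1 e1, II M p e1 e2, II M p e2 e2}" (is "_ = span ?S")
proof
  have e: "e1 \<in> T" "e2 \<in> T" using onb by (auto simp: tangent_onb_def)
  show "span ?S \<subseteq> P" unfolding II_span_def using e by (intro span_mono) blast
  have "II M p v w \<in> span ?S" if vw: "v \<in> T" "w \<in> T" for v w
  proof -
    obtain x y x' y' where "v = x *\<^sub>R e1 + y *\<^sub>R e2" "w = x' *\<^sub>R e1 + y' *\<^sub>R e2"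
      using onb_coeffs(4)[OF onb] vw by metis
    then have "II M p v w = x' *\<^sub>R (x *\<^sub>R II M p e1 e1 + y *\<^sub>R II M p e1 e2) +
        y' *\<^sub>R (x *\<^sub>R II M p e1 e2 + y *\<^sub>R II M p e2 e2)"
      by (simp only: II_linear[OF e] II_linear_right[OF e] II_commute[of e2 e1])
    also have "\<dots> \<in> span ?S"
      by (intro span_add span_scale; rule span_base) simp_all
    finally show ?thesis .
  qed
  then show "P \<subseteq> span ?S" unfolding II_span_def by (intro span_minimal) auto
qed

lemma II_in_span: "v \<in> T \<Longrightarrow> w \<in> T \<Longrightarrow> II M p v w \<in> P"
  unfolding II_span_def by (rule span_base) blast

lemma subspace_P: "subspace P" by (simp add: II_span_def)

lemma P_subset_N: "P \<subseteq> N"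
  unfolding II_span_def using II_N subspace_N by (intro span_minimal) auto

lemma dim_N: "dim N = 3"
proof -
  have "{y. \<forall>x\<in>T. orthogonal x y} = N" by (auto simp: normal_space_def orthogonal_comp_def)
  then have "dim N + dim T = DIM(real^5)"
    using dim_subspace_orthogonal_to_vectors[OF subspace_T subspace_UNIV] by (simp add: dim_UNIV)
  then show ?thesis using dim_T by simp
qed

text \<open>
  The columns of the matrix are the images of \<open>II(e1,e1)\<close>, \<open>II(e1,e2)\<close>, \<open>II(e2,e2)\<close> under the coordinate
  map of the normal frame, which is injective on the normal space.
\<close>

lemma rank_alpha:
  assumes onb: "tangent_onb M p e1 e2" and nf: "normal_frame M p n"
  shows "rank (alpha M p e1 e2 n) = dim P"
proof -
  let ?A = "alpha M p e1 e2 n"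
  define \<Lambda> :: "real^5 \<Rightarrow> real^3" where "\<Lambda> x = (\<chi> i. x \<bullet> n i)" for x
  have lin: "linear \<Lambda>" by (intro linearI) (simp_all add: \<Lambda>_def vec_eq_iff inner_add_left)
  have n: "n i \<in> N" "n i \<bullet> n j = (if i = j then 1 else 0)" for i j
    using nf by (auto simp: normal_frame_def)
  have "inj n" by (intro injI) (metis n(2) zero_neq_one)
  have ind: "independent (range n)"
  proof (rule pairwise_orthogonal_independent)
    show "pairwise orthogonal (range n)" by (auto simp: pairwise_def orthogonal_def n(2))
    show "0 \<notin> range n" using n(2) by (metis inner_zero_left rangeE zero_neq_one)
  qed
  have "N \<subseteq> span (range n)"
  proof (rule card_ge_dim_independent[OF _ ind])
    show "range n \<subseteq> N" using n(1) by auto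
    show "dim N \<le> card (range n)" using card_image[OF \<open>inj n\<close>] dim_N by simp
  qed
  have inj: "inj_on \<Lambda> N"
  proof (rule inj_onI)
    fix x y assume xy: "x \<in> N" "y \<in> N" "\<Lambda> x = \<Lambda> y"
    have "orthogonal (x - y) z" if "z \<in> range n" for z
      using xy(3) that by (auto simp: \<Lambda>_def vec_eq_iff orthogonal_def inner_diff_left)
    moreover have "x - y \<in> span (range n)"
      using \<open>N \<subseteq> span (range n)\<close> xy subspace_diff[OF subspace_N] by blast
    ultimately have "orthogonal (x - y) (x - y)" using orthogonal_to_span by blast
    then show "x = y" by (simp add: orthogonal_self)
  qed
  let ?S = "{II M p e1 e1, II M p e1 e2, II M p e2 e2}"
  have "columns ?A = \<Lambda> ` ?S"
  proof -
    have "column 1 ?A = \<Lambda> (II M p e1 e1)" "column 2 ?A = \<Lambda> (II M p e1 e2)" "column 3 ?A = \<Lambda> (II M p e2 e2)"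
      by (simp_all add: column_def alpha_def \<Lambda>_def)
    moreover have "columns ?A = {column 1 ?A, column 2 ?A, column 3 ?A}"
      by (auto simp: columns_def) (metis exhaust_3)
    ultimately show ?thesis by simp
  qed
  then have "rank ?A = dim (\<Lambda> ` ?S)" by (simp add: column_rank_def)
  also have "\<dots> = dim ?S"
    using inj_on_subset[OF inj P_subset_N] II_span_onb[OF onb] by (intro dim_image_eq[OF lin]) simp
  also have "\<dots> = dim P" by (simp add: II_span_onb[OF onb])
  finally show ?thesis .
qed

section \<open>The singular projection and its asymptotic plane\<close>

lemma sing_map_derivative:
  "ddir v (sing_map M p u) 0 = proj_along u (J v)"
  "D2 (sing_map M p u) 0 v w = proj_along u (D2 \<phi> 0 v w)"
proof -
  obtain U where U: "open U" "0 \<in> U" "smooth_on U \<phi>" using chart_smooth by blast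
  show "ddir v (sing_map M p u) 0 = proj_along u (J v)"
    unfolding sing_map_def using ddir_linear_image[OF linear_proj_along U(3,2)] .
  show "D2 (sing_map M p u) 0 v w = proj_along u (D2 \<phi> 0 v w)"
    unfolding sing_map_def using D2_linear_image[OF linear_proj_along U(1,3,2)] .
qed

text \<open>
  The line \<open>u\<close> and the image of the differential of the projection together span the tangent plane of \<open>M\<close>.
\<close>

lemma sing_normal_space_eq:
  assumes u: "u \<in> T"
  shows "sing_normal_space M p u = N"
proof -
  have rng: "range (frechet_derivative (sing_map M p u) (at 0)) = proj_along u ` T"
    unfolding T_eq_range image_image using sing_map_derivative(1)[unfolded ddir_def] by (simp add: ddir_def)
  have "(u \<bullet> x = 0 \<and> (\<forall>y\<in>T. proj_along u y \<bullet> x = 0)) \<longleftrightarrow> (\<forall>y\<in>T. y \<bullet> x = 0)" for x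
    using u by (auto simp: proj_along_def inner_diff_left)
  then show ?thesis
    unfolding sing_normal_space_def rng
    by (auto simp: normal_space_def orthogonal_comp_def orthogonal_def)
qed

text \<open>
  The projection along \<open>u\<close> changes second derivatives by a multiple of \<open>u\<close>, which has no normal component.
\<close>

lemma sing_II_eq:
  assumes u: "u \<in> T"
  shows "sing_II M p u v w = II M p v w"
proof (rule subspace_eq_by_inner[OF subspace_N _ II_N])
  show "sing_II M p u v w \<in> N"
    unfolding sing_II_def sing_normal_space_eq[OF u] by (rule orth_proj_subspace[OF subspace_N])
  fix \<nu> assume \<nu>: "\<nu> \<in> N"
  have "sing_II M p u v w \<bullet> \<nu> = proj_along u (D2 \<phi> 0 (coord M p v) (coord M p w)) \<bullet> \<nu>"
    unfolding sing_II_def sing_normal_space_eq[OF u] sing_map_derivative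
    by (rule orth_proj_subspace(2)[OF subspace_N \<nu>])
  then show "sing_II M p u v w \<bullet> \<nu> = II M p v w \<bullet> \<nu>"
    using N_perp[OF \<nu> u] by (simp add: II_inner[OF \<nu>] proj_along_def inner_diff_left)
qed

text \<open>
  A vector \<open>x u + y u'\<close> has length \<open>y\<^sup>2\<close> for the first fundamental form of the projection, and both signs
  of \<open>y = \<plusminus>1\<close> give the same set.
\<close>

lemma curvature_parabola_eq:
  assumes onb: "tangent_onb M p u u'"
  shows "curvature_parabola M p u =
    range (\<lambda>t. II M p u' u' + t *\<^sub>R (2 *\<^sub>R II M p u u') + t\<^sup>2 *\<^sub>R II M p u u)"
    (is "_ = range ?f")
proof -
  have u: "u \<in> T" "u' \<in> T" "u \<bullet> u = 1" "u' \<bullet> u' = 1" "u \<bullet> u' = 0" "u' \<bullet> u = 0"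
    using onb by (auto simp: tangent_onb_def orthogonal_def norm_eq_1 inner_commute)
  have I: "sing_I M p u w w = y\<^sup>2" if "w = x *\<^sub>R u + y *\<^sub>R u'" for w x y
  proof -
    have "w \<in> T" using that onb_coeffs(3)[OF onb] by simp
    have "proj_along u w = y *\<^sub>R u'" using u by (simp add: that proj_along_def inner_add_left)
    then show ?thesis
      using u by (simp add: sing_I_def sing_map_derivative J_coord[OF \<open>w \<in> T\<close>] power2_eq_square)
  qed
  have II: "sing_II M p u w w = ?f (x * y)" if "w = x *\<^sub>R u + y *\<^sub>R u'" "y\<^sup>2 = 1" for w x y
    using that by (simp add: sing_II_eq[OF u(1)] II_quadratic[OF u(1,2)] power_mult_distrib mult.commute)
  show ?thesis
  proof (intro equalityI subsetI)
    fix z assume "z \<in> curvature_parabola M p u"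
    then obtain w where w: "z = sing_II M p u w w" "w \<in> T" "sing_I M p u w w = 1"
      unfolding curvature_parabola_def by blast
    obtain x y where xy: "w = x *\<^sub>R u + y *\<^sub>R u'" using onb_coeffs(4)[OF onb w(2)] by blast
    have "z = ?f (x * y)" using II[OF xy] I[OF xy] w by simp
    then show "z \<in> range ?f" by (rule range_eqI)
  next
    fix z assume "z \<in> range ?f"
    then obtain t where t: "z = ?f t" by blast
    let ?w = "t *\<^sub>R u + 1 *\<^sub>R u'"
    have "z = sing_II M p u ?w ?w" "?w \<in> T" "sing_I M p u ?w ?w = 1"
      using II[OF refl, of 1 t] I[OF refl, of t 1] t onb_coeffs(3)[OF onb, of t 1] by simp_all
    then show "z \<in> curvature_parabola M p u" unfolding curvature_parabola_def by blast
  qed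
qed

text \<open>
  Since \<open>II(u,u)\<close>, \<open>II(u,u')\<close>, \<open>II(u',u')\<close> span a plane, the parabola is nondegenerate, a half-line or a
  line. In the first case its affine hull is \<open>P\<close>, and the only linear plane parallel to
  it is \<open>P\<close>. In the other cases a linear plane containing the affine hull contains the three vectors.
\<close>

lemma asymptotic_plane_iff:
  assumes onb: "tangent_onb M p u u'" and dimP: "dim P = 2"
  shows "asymptotic_plane M p u E \<longleftrightarrow> E = P"
proof -
  define A B C where "A = II M p u u" and "B = II M p u u'" and "C = II M p u' u'"
  let ?\<Delta> = "curvature_parabola M p u"
  define f where "f = (\<lambda>t::real. C + t *\<^sub>R (2 *\<^sub>R B) + t\<^sup>2 *\<^sub>R A)"
  have u: "u \<in> T" "u' \<in> T" using onb by (auto simp: tangent_onb_def)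
  have \<Delta>: "?\<Delta> = range f" unfolding curvature_parabola_eq[OF onb] f_def A_def B_def C_def ..
  have P: "P = span {A, B, C}" unfolding A_def B_def C_def by (rule II_span_onb[OF onb])
  have ABC: "A \<in> P" "B \<in> P" "C \<in> P" unfolding P by (auto intro: span_base)
  have \<Delta>P: "?\<Delta> \<subseteq> P"
    unfolding \<Delta> f_def using ABC subspace_P by (auto intro!: subspace_add subspace_scale)
  have hullP: "affine hull ?\<Delta> \<subseteq> P"
    using \<Delta>P subspace_P by (intro hull_minimal subspace_imp_affine)
  have E_eq: "E = P" if E: "subspace E" "dim E = 2" and sub: "affine hull ?\<Delta> \<subseteq> E"
  proof -
    have fE: "f t \<in> E" for t using sub hull_inc[of "f t" ?\<Delta> affine] \<Delta> by blast
    have CE: "C \<in> E" using fE[of 0] by (simp add: f_def)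
    \<comment> \<open>The coefficients of the parabola are linear combinations of its points.\<close>
    have "(1/4) *\<^sub>R (f 1 - f (-1)) \<in> E" by (intro subspace_scale subspace_diff fE E(1))
    moreover have "f 1 - f (-1) = 4 *\<^sub>R B" by (simp add: f_def flip: scaleR_add_left)
    ultimately have BE: "B \<in> E" by simp
    have "f 1 - C - 2 *\<^sub>R B \<in> E" by (intro subspace_scale subspace_diff fE E(1) CE BE)
    then have AE: "A \<in> E" by (simp add: f_def)
    have "P \<subseteq> E" unfolding P using AE BE CE E(1) by (intro span_minimal) auto
    then show ?thesis using subspace_dim_equal[OF subspace_P E(1)] dimP E(2) by simp
  qed
  have shape: "nondegenerate_parabola ?\<Delta> \<or> is_half_line ?\<Delta> \<or> is_line ?\<Delta>"
  proof (cases "A = 0")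
    case True
    have "B \<noteq> 0"
    proof
      assume "B = 0"
      then have "P = span {C}" unfolding P True by simp
      then have "dim P \<le> 1" using dim_le_card'[of "{C}"] by simp
      then show False using dimP by simp
    qed
    moreover have "?\<Delta> = range (\<lambda>t::real. C + t *\<^sub>R (2 *\<^sub>R B))" unfolding \<Delta> f_def True by simp
    ultimately have "is_line ?\<Delta>" unfolding is_line_def by (intro exI[of _ C] exI[of _ "2 *\<^sub>R B"]) simp
    then show ?thesis by simp
  next
    case A: False
    show ?thesis
    proof (cases "2 *\<^sub>R B \<in> span {A}")
      case False
      then have "2 *\<^sub>R B \<noteq> A" using span_base by force
      moreover have "independent {2 *\<^sub>R B, A}" using False A by (simp add: independent_insert)
      ultimately have "nondegenerate_parabola ?\<Delta>"
        unfolding nondegenerate_parabola_def \<Delta> f_def by blast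
      then show ?thesis by simp
    next
      case True
      then obtain k where k: "2 *\<^sub>R B = (2 * k) *\<^sub>R A"
        by (auto simp: span_singleton) (metis mult.commute nonzero_mult_div_cancel_left
            times_divide_eq_left zero_neq_numeral)
      \<comment> \<open>Completing the square shows that the quadratic parametrization folds onto a half-line.\<close>
      have ft: "f t = (C - k\<^sup>2 *\<^sub>R A) + (t + k)\<^sup>2 *\<^sub>R A" for t
        unfolding f_def k by (simp add: power2_sum scaleR_add_left mult_ac)
      have "range f = {(C - k\<^sup>2 *\<^sub>R A) + s *\<^sub>R A | s. s \<ge> 0}"
      proof (intro equalityI subsetI)
        fix z assume "z \<in> {(C - k\<^sup>2 *\<^sub>R A) + s *\<^sub>R A | s. s \<ge> 0}"
        then obtain s where s: "z = (C - k\<^sup>2 *\<^sub>R A) + s *\<^sub>R A" "s \<ge> 0" by blast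
        then have "z = f (sqrt s - k)" unfolding ft by simp
        then show "z \<in> range f" by blast
      next
        fix z assume "z \<in> range f"
        then obtain t where "z = (C - k\<^sup>2 *\<^sub>R A) + (t + k)\<^sup>2 *\<^sub>R A" using ft by blast
        then show "z \<in> {(C - k\<^sup>2 *\<^sub>R A) + s *\<^sub>R A | s. s \<ge> 0}" using zero_le_power2 by blast
      qed
      then have "is_half_line ?\<Delta>" unfolding is_half_line_def \<Delta> using A by blast
      then show ?thesis by simp
    qed
  qed
  show ?thesis
  proof
    assume as: "asymptotic_plane M p u E"
    then have E: "subspace E" "dim E = 2" by (auto simp: asymptotic_plane_def)
    show "E = P"
    proof (cases "nondegenerate_parabola ?\<Delta>")
      case True
      have "affine_parallel P E"
        using as True affine_hull_nondegenerate_parabola[OF True \<Delta>P subspace_P dimP]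
        by (auto simp: asymptotic_plane_def Let_def)
      then obtain a where a: "E = (\<lambda>x. a + x) ` P" unfolding affine_parallel_def by blast
      have "0 \<in> E" using E(1) subspace_0 by blast
      then obtain x where "x \<in> P" "a + x = 0" using a by force
      then have "- a \<in> P" by (metis add_eq_0_iff2 minus_minus add.inverse_unique)
      then have "a \<in> P" using subspace_neg[OF subspace_P] by fastforce
      then have "P \<subseteq> E" unfolding a
        by (metis (no_types, lifting) add_diff_cancel_left' diff_add_cancel image_iff subsetI subspace_P subspace_diff add.commute)
      then show ?thesis using subspace_dim_equal[OF subspace_P E(1)] dimP E(2) by simp
    next
      case False
      then show ?thesis using E_eq[OF E] as shape by (auto simp: asymptotic_plane_def Let_def)
    qed
  next
    assume "E = P"
    then show "asymptotic_plane M p u E"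
      unfolding asymptotic_plane_def Let_def sing_normal_space_eq[OF u(1)]
      using subspace_P dimP P_subset_N hullP affine_parallel_reflex
        affine_hull_nondegenerate_parabola[OF _ \<Delta>P subspace_P dimP] by auto
  qed
qed

text \<open>
  A quarter turn of \<open>u\<close> in the tangent plane.
\<close>

lemma onb_extension:
  assumes onb: "tangent_onb M p e1 e2" and u: "u \<in> T" "norm u = 1"
  obtains u' where "tangent_onb M p u u'"
proof -
  obtain x y where xy: "u = x *\<^sub>R e1 + y *\<^sub>R e2" using onb_coeffs(4)[OF onb u(1)] by blast
  let ?u' = "(- y) *\<^sub>R e1 + x *\<^sub>R e2"
  have e: "e1 \<bullet> e1 = 1" "e2 \<bullet> e2 = 1" "e1 \<bullet> e2 = 0" "e2 \<bullet> e1 = 0"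
    using onb by (auto simp: tangent_onb_def orthogonal_def norm_eq_1 inner_commute)
  have "x\<^sup>2 + y\<^sup>2 = 1" using onb_coeffs(2)[OF onb, of x y] u(2) by (simp add: xy)
  then have "norm ?u' ^ 2 = 1" using onb_coeffs(2)[OF onb, of "-y" x] by simp
  then have "norm ?u' = 1" by (simp add: power2_eq_1_iff) (metis norm_ge_zero neg_0_le_iff_le not_one_le_zero)
  moreover have "orthogonal u ?u'"
    unfolding xy orthogonal_def by (simp add: inner_add_left inner_diff_left inner_add_right inner_diff_right e)
  ultimately have "tangent_onb M p u ?u'"
    using u onb_coeffs(3)[OF onb, of "-y" x] by (simp add: tangent_onb_def)
  then show ?thesis by (rule that)
qed

lemma sing_asymptotic_iff:
  assumes "tangent_onb M p e1 e2" "dim P = 2" "u \<in> T" "norm u = 1"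
  shows "sing_asymptotic M p u v \<longleftrightarrow>
    v \<in> T \<and> v \<noteq> 0 \<and> (\<exists>\<nu>\<in>P. \<nu> \<noteq> 0 \<and> (\<forall>w\<in>T. II M p v w \<bullet> \<nu> = 0))"
proof -
  obtain u' where u': "tangent_onb M p u u'" using onb_extension[OF assms(1,3,4)] .
  show ?thesis
    unfolding sing_asymptotic_def asymptotic_plane_iff[OF u' assms(2)] sing_II_eq[OF assms(3)] by blast
qed

section \<open>The type of a point of rank two\<close>

lemma curvature_ellipse_onb:
  assumes onb: "tangent_onb M p e1 e2"
  shows "curvature_ellipse M p = {x\<^sup>2 *\<^sub>R II M p e1 e1 + (2 * (x * y)) *\<^sub>R II M p e1 e2 + y\<^sup>2 *\<^sub>R II M p e2 e2
    | x y. x\<^sup>2 + y\<^sup>2 = 1}"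
proof -
  have e: "e1 \<in> T" "e2 \<in> T" using onb by (auto simp: tangent_onb_def)
  have nrm: "norm (x *\<^sub>R e1 + y *\<^sub>R e2) = 1 \<longleftrightarrow> x\<^sup>2 + y\<^sup>2 = 1" for x y
    using onb_coeffs(2)[OF onb, of x y] by (metis norm_ge_zero one_power2 power2_eq_imp_eq zero_le_one)
  show ?thesis
  proof (intro equalityI subsetI)
    fix z assume "z \<in> curvature_ellipse M p"
    then obtain w where w: "z = II M p w w" "w \<in> T" "norm w = 1" unfolding curvature_ellipse_def by blast
    obtain x y where xy: "w = x *\<^sub>R e1 + y *\<^sub>R e2" using onb_coeffs(4)[OF onb w(2)] by blast
    show "z \<in> {x\<^sup>2 *\<^sub>R II M p e1 e1 + (2 * (x * y)) *\<^sub>R II M p e1 e2 + y\<^sup>2 *\<^sub>R II M p e2 e2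
    | x y. x\<^sup>2 + y\<^sup>2 = 1}"
      using w(1,3) unfolding xy nrm II_quadratic[OF e] by blast
  next
    fix z assume "z \<in> {x\<^sup>2 *\<^sub>R II M p e1 e1 + (2 * (x * y)) *\<^sub>R II M p e1 e2 + y\<^sup>2 *\<^sub>R II M p e2 e2
    | x y. x\<^sup>2 + y\<^sup>2 = 1}"
    then obtain x y where "z = II M p (x *\<^sub>R e1 + y *\<^sub>R e2) (x *\<^sub>R e1 + y *\<^sub>R e2)" "x\<^sup>2 + y\<^sup>2 = 1"
      unfolding II_quadratic[OF e] by blast
    then show "z \<in> curvature_ellipse M p"
      unfolding curvature_ellipse_def using nrm onb_coeffs(3)[OF onb] by blast
  qed
qed

text \<open>
  The three alternatives are the three signs of the discriminant \<open>\<beta>\<^sup>2 - \<alpha>\<gamma>\<close> of the relation between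
  the values of the second fundamental form. As the types exclude each other on both sides, the
  implications of this lemma give equivalences.
\<close>

lemma rank_two_trichotomy:
  assumes rank2: "p \<in> rank_stratum M 2" and u: "u \<in> T" "norm u = 1"
  shows "p \<in> M2h M \<and> hyperbolic_point M p u \<or> p \<in> M2e M \<and> elliptic_point M p u \<or>
    p \<in> M2p M \<and> parabolic_point M p u"
proof -
  obtain e1 e2 n where onb: "tangent_onb M p e1 e2" and "normal_frame M p n" "rank (alpha M p e1 e2 n) = 2"
    using rank2 unfolding rank_stratum_def by blast
  then have dimP: "dim P = 2" using rank_alpha by simp
  have e: "e1 \<in> T" "e2 \<in> T" using onb by (auto simp: tangent_onb_def)
  define A B C where "A = II M p e1 e1" and "B = II M p e1 e2" and "C = II M p e2 e2"
  have P: "P = span {A, B, C}" unfolding A_def B_def C_def by (rule II_span_onb[OF onb])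
  have "dim (span {A, B, C}) = 2" using dimP P by simp
  then obtain \<alpha> \<beta> \<gamma> :: real where nz: "\<alpha> \<noteq> 0 \<or> \<beta> \<noteq> 0 \<or> \<gamma> \<noteq> 0"
    and rel: "\<alpha> *\<^sub>R A + (2 * \<beta>) *\<^sub>R B + \<gamma> *\<^sub>R C = 0"
    and uniq: "\<And>a b c. a *\<^sub>R A + (2 * b) *\<^sub>R B + c *\<^sub>R C = 0 \<Longrightarrow> \<exists>r. a = r * \<alpha> \<and> b = r * \<beta> \<and> c = r * \<gamma>"
    and ann: "\<And>x y. (\<exists>\<nu>\<in>span {A, B, C}. \<nu> \<noteq> 0 \<and> (x *\<^sub>R A + y *\<^sub>R B) \<bullet> \<nu> = 0 \<and> (x *\<^sub>R B + y *\<^sub>R C) \<bullet> \<nu> = 0)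
        \<longleftrightarrow> \<gamma> * x\<^sup>2 - 2 * \<beta> * x * y + \<alpha> * y\<^sup>2 = 0"
    using plane_relation by blast
  have asym: "sing_asymptotic M p u (x *\<^sub>R e1 + y *\<^sub>R e2) \<longleftrightarrow>
      (x \<noteq> 0 \<or> y \<noteq> 0) \<and> \<gamma> * x\<^sup>2 - 2 * \<beta> * x * y + \<alpha> * y\<^sup>2 = 0" for x y
  proof -
    let ?v = "x *\<^sub>R e1 + y *\<^sub>R e2"
    have ker: "(\<forall>w\<in>T. II M p ?v w \<bullet> \<nu> = 0) \<longleftrightarrow> (x *\<^sub>R A + y *\<^sub>R B) \<bullet> \<nu> = 0 \<and> (x *\<^sub>R B + y *\<^sub>R C) \<bullet> \<nu> = 0" for \<nu>
    proof -
      have ve: "II M p ?v e1 = x *\<^sub>R A + y *\<^sub>R B" "II M p ?v e2 = x *\<^sub>R B + y *\<^sub>R C"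
        unfolding A_def B_def C_def II_linear[OF e] by (simp_all only: II_commute[of e2 e1])
      have "(\<forall>w\<in>T. II M p ?v w \<bullet> \<nu> = 0) \<longleftrightarrow> II M p ?v e1 \<bullet> \<nu> = 0 \<and> II M p ?v e2 \<bullet> \<nu> = 0"
      proof
        assume r: "II M p ?v e1 \<bullet> \<nu> = 0 \<and> II M p ?v e2 \<bullet> \<nu> = 0"
        show "\<forall>w\<in>T. II M p ?v w \<bullet> \<nu> = 0"
        proof
          fix w assume "w \<in> T"
          then obtain s t where "w = s *\<^sub>R e1 + t *\<^sub>R e2" using onb_coeffs(4)[OF onb] by blast
          then show "II M p ?v w \<bullet> \<nu> = 0" using r by (simp add: II_linear_right[OF e] inner_add_left)
        qed
      qed (use e in blast)
      then show ?thesis unfolding ve .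
    qed
    have "?v \<noteq> 0 \<longleftrightarrow> x \<noteq> 0 \<or> y \<noteq> 0" using onb_coeffs(1)[OF onb, of x y] by auto
    then show ?thesis
      unfolding sing_asymptotic_iff[OF onb dimP u] ker P ann using onb_coeffs(3)[OF onb] by blast
  qed
  let ?L = "{span {x *\<^sub>R e1 + y *\<^sub>R e2} | x y. (x \<noteq> 0 \<or> y \<noteq> 0) \<and> \<gamma> * x\<^sup>2 - 2 * \<beta> * x * y + \<alpha> * y\<^sup>2 = 0}"
  have L: "directions (sing_asymptotic M p u) = ?L"
  proof -
    have "\<exists>x y. v = x *\<^sub>R e1 + y *\<^sub>R e2" if "sing_asymptotic M p u v" for v
      using that onb_coeffs(4)[OF onb] by (auto simp: sing_asymptotic_def)
    then have "directions (sing_asymptotic M p u) =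
        {span {x *\<^sub>R e1 + y *\<^sub>R e2} | x y. sing_asymptotic M p u (x *\<^sub>R e1 + y *\<^sub>R e2)}"
      unfolding directions_def by blast
    then show ?thesis unfolding asym .
  qed
  have card: "\<beta>\<^sup>2 - \<alpha> * \<gamma> > 0 \<Longrightarrow> card ?L = 2" "\<beta>\<^sup>2 - \<alpha> * \<gamma> = 0 \<Longrightarrow> card ?L = 1"
    "\<beta>\<^sup>2 - \<alpha> * \<gamma> < 0 \<Longrightarrow> ?L = {}"
    by (rule card_lines_binary_form[OF onb_coeffs(1)[OF onb] nz]; assumption)+
  have ell: "curvature_ellipse M p =
      {x\<^sup>2 *\<^sub>R A + (2 * (x * y)) *\<^sub>R B + y\<^sup>2 *\<^sub>R C | x y. x\<^sup>2 + y\<^sup>2 = 1}"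
    unfolding A_def B_def C_def by (rule curvature_ellipse_onb[OF onb])
  note zero = zero_in_ellipse_hull[OF nz rel uniq, folded ell]
  consider "\<beta>\<^sup>2 - \<alpha> * \<gamma> > 0" | "\<beta>\<^sup>2 - \<alpha> * \<gamma> = 0" | "\<beta>\<^sup>2 - \<alpha> * \<gamma> < 0" by linarith
  then show ?thesis
  proof cases
    case 1
    then show ?thesis using zero(1) card(1) rank2 L by (simp add: M2h_def hyperbolic_point_def)
  next
    case 2
    then show ?thesis using zero(2) card(2) rank2 L by (simp add: M2p_def parabolic_point_def)
  next
    case 3
    then show ?thesis using zero(3) card(3) rank2 L by (simp add: M2e_def elliptic_point_def)
  qed
qed

section \<open>Height functions and asymptotic directions\<close>

lemma height_derivatives:
  "ddir a (height M p \<nu>) 0 = J a \<bullet> \<nu>"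
  "D2 (height M p \<nu>) 0 a b = D2 \<phi> 0 a b \<bullet> \<nu>"
  "D3 (height M p \<nu>) 0 a b c = D3 \<phi> 0 a b c \<bullet> \<nu>"
proof -
  obtain U where U: "open U" "0 \<in> U" "smooth_on U \<phi>" using chart_smooth by blast
  note L = linear_inner_right_arg[of \<nu>]
  show "ddir a (height M p \<nu>) 0 = J a \<bullet> \<nu>"
    unfolding height_def using ddir_linear_image[OF L U(3,2)] .
  show "D2 (height M p \<nu>) 0 a b = D2 \<phi> 0 a b \<bullet> \<nu>"
    unfolding height_def using D2_linear_image[OF L U(1,3,2)] .
  show "D3 (height M p \<nu>) 0 a b c = D3 \<phi> 0 a b c \<bullet> \<nu>"
    unfolding height_def using D3_linear_image[OF L U(1,3,2)] .
qed

lemma height_smooth: "\<exists>U. open U \<and> 0 \<in> U \<and> smooth_on U (height M p \<nu>)"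
  using chart_smooth smooth_on_linear_image[OF linear_inner_right_arg] unfolding height_def by blast

lemma height_critical: "\<nu> \<in> N \<Longrightarrow> ddir a (height M p \<nu>) 0 = 0"
  using N_perp[of \<nu> "J a"] by (simp add: height_derivatives T_eq_range)

lemma height_Hessian: "\<nu> \<in> N \<Longrightarrow> D2 (height M p \<nu>) 0 (coord M p v) (coord M p w) = II M p v w \<bullet> \<nu>"
  by (simp add: height_derivatives II_inner)

lemma height_Hessian_J: "\<nu> \<in> N \<Longrightarrow> D2 (height M p \<nu>) 0 a b = II M p (J a) (J b) \<bullet> \<nu>"
  using height_Hessian[of \<nu> "J a" "J b"] by (simp add: coord_J)

lemma coord_nonzero: "v \<in> T \<Longrightarrow> v \<noteq> 0 \<Longrightarrow> coord M p v \<noteq> 0"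
  using J_coord linear_0[OF linear_J] by metis

text \<open>
  The Hessian of the height function is the \<open>\<nu>\<close>-component of the second fundamental form, and at an
  \<open>A\<^sub>k\<close> singularity it is nonzero.
\<close>

lemma A_sing_height_not_perp:
  assumes \<nu>: "\<nu> \<in> N" and A: "A_sing k (height M p \<nu>)" "k \<ge> 1"
  shows "\<exists>x\<in>P. x \<bullet> \<nu> \<noteq> 0"
proof -
  obtain U where U: "open U" "0 \<in> U" "smooth_on U (height M p \<nu>)" using height_smooth by blast
  obtain a where "D2 (height M p \<nu>) 0 a a \<noteq> 0"
    using A_sing_Hessian_nonzero[OF U height_critical[OF \<nu>] A] by blast
  then have "II M p (J a) (J a) \<bullet> \<nu> \<noteq> 0" by (simp add: height_Hessian_J[OF \<nu>])
  moreover have "II M p (J a) (J a) \<in> P" by (rule II_in_span) (simp_all add: T_eq_range)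
  ultimately show ?thesis by blast
qed

lemma D_sing_height_perp:
  assumes \<nu>: "\<nu> \<in> N" and D: "D_sing k (height M p \<nu>)" "k \<ge> 4" and x: "x \<in> P"
  shows "x \<bullet> \<nu> = 0"
proof -
  obtain U where U: "open U" "0 \<in> U" "smooth_on U (height M p \<nu>)" using height_smooth by blast
  have diag: "II M p w w \<bullet> \<nu> = 0" for w
    using D_sing_Hessian_zero[OF U height_critical[OF \<nu>] D] by (simp flip: height_Hessian[OF \<nu>])
  have "II M p v w \<bullet> \<nu> = 0" if "v \<in> T" "w \<in> T" for v w
    using diag[of "1 *\<^sub>R v + 1 *\<^sub>R w"] unfolding II_quadratic[OF that]
    by (simp add: inner_add_left diag)
  then have "orthogonal \<nu> y" if "y \<in> {II M p v w | v w. v \<in> T \<and> w \<in> T}" for y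
    using that by (auto simp: orthogonal_def inner_commute)
  then have "orthogonal \<nu> x" using orthogonal_to_span x unfolding II_span_def by blast
  then show ?thesis by (simp add: orthogonal_def inner_commute)
qed

text \<open>
  Only the component of \<open>\<nu>\<close> in \<open>P\<close> enters the Hessian, so it can replace \<open>\<nu>\<close>; it is nonzero as the
  Hessian is.
\<close>

lemma A_asymptotic_imp_sing_asymptotic:
  assumes "tangent_onb M p e1 e2" "dim P = 2" "u \<in> T" "norm u = 1" and A: "A_asymptotic k M p v"
  shows "sing_asymptotic M p u v"
proof -
  obtain \<nu> where k: "k \<ge> 3" and \<nu>: "contact_dir M p \<nu> v" "A_sing k (height M p \<nu>)"
    using A unfolding A_asymptotic_def by blast
  have \<nu>N: "\<nu> \<in> N" and v: "v \<in> T" "norm v = 1" and ker: "\<And>w. w \<in> T \<Longrightarrow> II M p v w \<bullet> \<nu> = 0"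
    using \<nu>(1) height_Hessian
    by (auto simp: contact_dir_def degenerate_dir_def unit_normal_def unit_tangent_def)
  let ?\<nu>' = "orth_proj P \<nu>"
  have proj: "?\<nu>' \<in> P" "\<And>x. x \<in> P \<Longrightarrow> x \<bullet> ?\<nu>' = x \<bullet> \<nu>"
    using orth_proj_subspace(1)[OF subspace_P] orth_proj_subspace(2)[OF subspace_P, of _ \<nu>]
    by (simp_all add: inner_commute)
  obtain x where "x \<in> P" "x \<bullet> \<nu> \<noteq> 0" using A_sing_height_not_perp[OF \<nu>N \<nu>(2)] k by auto
  then have "?\<nu>' \<noteq> 0" using proj(2)[of x] by auto
  moreover have "II M p v w \<bullet> ?\<nu>' = 0" if "w \<in> T" for w
    using proj(2)[OF II_in_span[OF v(1) that]] ker[OF that] by simp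
  ultimately show ?thesis
    using proj(1) v unfolding sing_asymptotic_iff[OF assms(1-4)] by auto
qed

text \<open>
  A contact direction excludes \<open>A\<^sub>1\<close>, and a nonzero Hessian excludes \<open>D\<^sub>4\<close> and \<open>D\<^sub>5\<close>; a generic
  surface leaves \<open>A\<^sub>2\<close>, ..., \<open>A\<^sub>5\<close>.
\<close>

lemma kernel_direction_singularity:
  assumes generic: "generic_surface M" and \<nu>: "unit_normal M p \<nu>" and v: "unit_tangent M p v"
    and ker: "\<And>w. w \<in> T \<Longrightarrow> II M p v w \<bullet> \<nu> = 0" and x: "x \<in> P" "x \<bullet> \<nu> \<noteq> 0"
  shows "contact_dir M p \<nu> v"
    and "\<not> A_sing 2 (height M p \<nu>) \<Longrightarrow> \<exists>k. A_asymptotic k M p v"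
proof -
  let ?h = "height M p \<nu>"
  have \<nu>N: "\<nu> \<in> N" using \<nu> by (simp add: unit_normal_def)
  have vT: "v \<in> T" "v \<noteq> 0" using v by (auto simp: unit_tangent_def)
  obtain U where U: "open U" "0 \<in> U" "smooth_on U ?h" using height_smooth by blast
  have crit: "frechet_derivative ?h (at 0) = (\<lambda>_. 0)"
    using height_critical[OF \<nu>N] by (auto simp: ddir_def)
  have not1: "\<not> A_sing 1 ?h"
  proof
    assume "A_sing 1 ?h"
    then obtain b where "D2 ?h 0 (coord M p v) b \<noteq> 0"
      using A1_Hessian_nondegenerate[OF U height_critical[OF \<nu>N] _ coord_nonzero[OF vT]] by blast
    moreover have "D2 ?h 0 (coord M p v) b = II M p v (J b) \<bullet> \<nu>"
      using height_Hessian_J[OF \<nu>N] J_coord[OF vT(1)] by simp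
    ultimately show False using ker[of "J b"] by (simp add: T_eq_range)
  qed
  have "\<And>j. j \<in> {1..<2} \<Longrightarrow> j = (1::nat)" by auto
  then have "A_or_worse 2 ?h" unfolding A_or_worse_def using crit not1 by blast
  then show contact: "contact_dir M p \<nu> v"
    using \<nu> v ker by (auto simp: contact_dir_def degenerate_dir_def height_Hessian[OF \<nu>N])
  assume not2: "\<not> A_sing 2 ?h"
  have "\<not> D_sing k ?h" if "k \<ge> 4" for k
    using D_sing_height_perp[OF \<nu>N _ that x(1)] x(2) by blast
  then have "\<not> D_sing 4 ?h" "\<not> D_sing 5 ?h" by simp_all
  then obtain k where k: "k \<in> {1..5}" "A_sing k ?h"
    using generic \<nu> on_surface unfolding generic_surface_def by blast
  then have "k \<noteq> 1" "k \<noteq> 2" using not1 not2 by auto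
  then have "k \<ge> 3" using k by auto
  moreover have "\<And>j. j \<in> {1..<3} \<Longrightarrow> j = 1 \<or> j = (2::nat)" by auto
  then have "A_or_worse 3 ?h" unfolding A_or_worse_def using crit not1 not2 by blast
  ultimately show "\<exists>k. A_asymptotic k M p v"
    unfolding A_asymptotic_def binormal_dir_def using contact k(2) \<nu> by blast
qed

text \<open>
  If the direction \<open>\<nu>\<close> in \<open>P\<close> gives an \<open>A\<^sub>2\<close> singularity, it is tilted to \<open>\<nu> + t \<mu>\<close> with \<open>\<mu>\<close> normal to
  \<open>P\<close>, where \<open>t\<close> is chosen such that the cubic form vanishes on \<open>v\<close>.
\<close>

lemma sing_asymptotic_imp_A_asymptotic:
  assumes "tangent_onb M p e1 e2" "dim P = 2" "u \<in> T" "norm u = 1"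
    and generic: "generic_surface M" and no_A2: "no_A2_contact_on_cubic M p"
    and v: "unit_tangent M p v" and as: "sing_asymptotic M p u v"
  shows "\<exists>k. A_asymptotic k M p v"
proof -
  obtain \<nu>0 where \<nu>0: "\<nu>0 \<in> P" "\<nu>0 \<noteq> 0" "\<And>w. w \<in> T \<Longrightarrow> II M p v w \<bullet> \<nu>0 = 0"
    using as unfolding sing_asymptotic_iff[OF assms(1-4)] by blast
  define \<nu> where "\<nu> = (1 / norm \<nu>0) *\<^sub>R \<nu>0"
  have \<nu>P: "\<nu> \<in> P" unfolding \<nu>_def using \<nu>0(1) subspace_P by (rule subspace_scale[rotated])
  have n1: "norm \<nu> = 1" using \<nu>0(2) by (simp add: \<nu>_def)
  then have \<nu>\<nu>: "\<nu> \<bullet> \<nu> = 1" by (simp add: norm_eq_1)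
  have \<nu>: "unit_normal M p \<nu>" using \<nu>P n1 P_subset_N by (auto simp: unit_normal_def)
  have ker: "II M p v w \<bullet> \<nu> = 0" if "w \<in> T" for w using \<nu>0(3)[OF that] by (simp add: \<nu>_def)
  show ?thesis
  proof (cases "A_sing 2 (height M p \<nu>)")
    case False
    then show ?thesis
      using kernel_direction_singularity(2)[OF generic \<nu> v ker \<nu>P] \<nu>\<nu> by simp
  next
    case True
    have contact: "contact_dir M p \<nu> v"
      using kernel_direction_singularity(1)[OF generic \<nu> v ker \<nu>P] \<nu>\<nu> by simp
    have "P \<noteq> N" using dim_N assms(2) by auto
    then have "span P \<subset> span N"
      using P_subset_N span_eq_iff subspace_P subspace_N by (metis psubsetI)
    then obtain \<mu>0 where \<mu>0: "\<mu>0 \<noteq> 0" "\<mu>0 \<in> span N" "\<And>x. x \<in> span P \<Longrightarrow> orthogonal \<mu>0 x"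
      using orthogonal_to_subspace_exists_gen by metis
    define \<mu> where "\<mu> = (1 / norm \<mu>0) *\<^sub>R \<mu>0"
    have \<mu>N: "\<mu> \<in> N" using \<mu>0(2) subspace_N unfolding \<mu>_def by (metis span_eq_iff subspace_scale)
    have \<mu>: "unit_normal M p \<mu>" using \<mu>N \<mu>0(1) by (simp add: unit_normal_def \<mu>_def)
    have \<mu>P: "x \<bullet> \<mu> = 0" if "x \<in> P" for x
      using \<mu>0(3)[of x] that by (simp add: \<mu>_def orthogonal_def inner_commute span_base)
    have "\<not> A_sing k (height M p \<mu>)" if "k \<ge> 1" for k
      using A_sing_height_not_perp[OF \<mu>N _ that] \<mu>P by blast
    then have "D_sing 4 (height M p \<mu>) \<or> D_sing 5 (height M p \<mu>)"
      using generic \<mu> on_surface unfolding generic_surface_def by (metis atLeastAtMost_iff)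
    then have "\<exists>k\<ge>4. D_sing k (height M p \<mu>)" by (auto intro: exI[of _ 4] exI[of _ 5])
    then have cubic: "cubic_form M p \<mu> v \<noteq> 0"
      using no_A2 contact True \<mu> unfolding no_A2_contact_on_cubic_def by blast
    \<comment> \<open>The multiple of \<open>\<mu>\<close> that makes the cubic form of \<open>\<nu> + t \<mu>\<close> vanish on \<open>v\<close>.\<close>
    define t where "t = - cubic_form M p \<nu> v / cubic_form M p \<mu> v"
    define \<xi> where "\<xi> = (1 / norm (\<nu> + t *\<^sub>R \<mu>)) *\<^sub>R (\<nu> + t *\<^sub>R \<mu>)"
    have ne: "\<nu> + t *\<^sub>R \<mu> \<noteq> 0"
    proof
      assume "\<nu> + t *\<^sub>R \<mu> = 0"
      then have "\<nu> \<bullet> (\<nu> + t *\<^sub>R \<mu>) = 0" by simp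
      then show False using \<mu>P[OF \<nu>P] \<nu>\<nu> by (simp add: inner_add_right)
    qed
    have \<xi>_inner: "x \<bullet> \<xi> = (x \<bullet> \<nu> + t * (x \<bullet> \<mu>)) / norm (\<nu> + t *\<^sub>R \<mu>)" for x
      by (simp add: \<xi>_def inner_add_right)
    have \<xi>N: "\<xi> \<in> N" unfolding \<xi>_def
      using \<mu>N \<nu> subspace_N by (intro subspace_scale subspace_add) (auto simp: unit_normal_def)
    have \<xi>: "unit_normal M p \<xi>" using \<xi>N ne by (simp add: unit_normal_def \<xi>_def)
    have vT: "v \<in> T" "v \<noteq> 0" using v by (auto simp: unit_tangent_def)
    have ker\<xi>: "II M p v w \<bullet> \<xi> = 0" if "w \<in> T" for w
      using ker[OF that] \<mu>P[OF II_in_span[OF vT(1) that]] by (simp add: \<xi>_inner)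
    have not_perp: "\<nu> \<bullet> \<xi> \<noteq> 0" using \<mu>P[OF \<nu>P] \<nu>\<nu> ne by (simp add: \<xi>_inner)
    have "\<not> A_sing 2 (height M p \<xi>)"
    proof
      assume A2: "A_sing 2 (height M p \<xi>)"
      obtain U where U: "open U" "0 \<in> U" "smooth_on U (height M p \<xi>)" using height_smooth by blast
      let ?c = "coord M p v"
      have "D2 (height M p \<xi>) 0 ?c ?c = 0" using ker\<xi>[OF vT(1)] by (simp add: height_Hessian[OF \<xi>N])
      then have "D3 (height M p \<xi>) 0 ?c ?c ?c \<noteq> 0"
        using A2_cubic_nonzero[OF U height_critical[OF \<xi>N] A2 coord_nonzero[OF vT]] by blast
      moreover have "D3 (height M p \<xi>) 0 ?c ?c ?c
          = (cubic_form M p \<nu> v + t * cubic_form M p \<mu> v) / norm (\<nu> + t *\<^sub>R \<mu>)"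
        by (simp add: cubic_form_def height_derivatives \<xi>_inner)
      moreover have "cubic_form M p \<nu> v + t * cubic_form M p \<mu> v = 0" using cubic by (simp add: t_def)
      ultimately show False by simp
    qed
    then show ?thesis
      using kernel_direction_singularity(2)[OF generic \<xi> v _ \<nu>P not_perp] ker\<xi> by blast
  qed
qed

end

theorem theorem3p9:
  fixes M :: "(real^5) set" and p u :: "real^5"
  assumes "regular_surface M" and "generic_surface M"
    and "p \<in> M" and "p \<in> rank_stratum M 2"
    and "u \<in> tangent_space M p" and "norm u = 1"
  shows "(p \<in> M2h M \<longleftrightarrow> hyperbolic_point M p u) \<and>
         (p \<in> M2e M \<longleftrightarrow> elliptic_point M p u) \<and>
         (p \<in> M2p M \<longleftrightarrow> parabolic_point M p u) \<and>
         (\<forall>v. unit_tangent M p v \<and> (\<exists>k. A_asymptotic k M p v) \<longrightarrow> sing_asymptotic M p u v) \<and>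
         (no_A2_contact_on_cubic M p \<longrightarrow>
            (\<forall>v. unit_tangent M p v \<longrightarrow>
               ((\<exists>k. A_asymptotic k M p v) \<longleftrightarrow> sing_asymptotic M p u v)) \<and>
            (p \<in> M2h M \<longrightarrow>
               directions (\<lambda>v. \<exists>k. A_asymptotic k M p v) = directions (sing_asymptotic M p u) \<and>
               card (directions (\<lambda>v. \<exists>k. A_asymptotic k M p v)) = 2) \<and>
            (p \<in> M2p M \<longrightarrow>
               directions (\<lambda>v. \<exists>k. A_asymptotic k M p v) = directions (sing_asymptotic M p u) \<and>
               card (directions (\<lambda>v. \<exists>k. A_asymptotic k M p v)) = 1))"
proof -
  interpret surface_point M p using assms(1,3) by unfold_locales
  note u = assms(5,6)
  obtain e1 e2 n where onb: "tangent_onb M p e1 e2" and "normal_frame M p n" "rank (alpha M p e1 e2 n) = 2"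
    using assms(4) unfolding rank_stratum_def by blast
  then have dimP: "dim P = 2" using rank_alpha by simp
  have trichotomy: "(p \<in> M2h M \<longleftrightarrow> hyperbolic_point M p u) \<and> (p \<in> M2e M \<longleftrightarrow> elliptic_point M p u) \<and>
      (p \<in> M2p M \<longleftrightarrow> parabolic_point M p u)"
  proof -
    have "\<not> (p \<in> M2h M \<and> p \<in> M2e M)" "\<not> (p \<in> M2h M \<and> p \<in> M2p M)" "\<not> (p \<in> M2e M \<and> p \<in> M2p M)"
      using hull_inc[of 0 "curvature_ellipse M p" convex] by (auto simp: M2h_def M2e_def M2p_def)
    moreover have "\<not> (hyperbolic_point M p u \<and> elliptic_point M p u)"
      "\<not> (hyperbolic_point M p u \<and> parabolic_point M p u)"
      "\<not> (elliptic_point M p u \<and> parabolic_point M p u)"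
      by (auto simp: hyperbolic_point_def elliptic_point_def parabolic_point_def)
    ultimately show ?thesis using rank_two_trichotomy[OF assms(4) u] by blast
  qed
  have forward: "sing_asymptotic M p u v" if "\<exists>k. A_asymptotic k M p v" for v
    using that A_asymptotic_imp_sing_asymptotic[OF onb dimP u] by blast
  have iff: "(\<exists>k. A_asymptotic k M p v) \<longleftrightarrow> sing_asymptotic M p u v"
    if "no_A2_contact_on_cubic M p" "unit_tangent M p v" for v
    using forward sing_asymptotic_imp_A_asymptotic[OF onb dimP u assms(2) that] by blast
  have dirs: "directions (\<lambda>v. \<exists>k. A_asymptotic k M p v) = directions (sing_asymptotic M p u)"
    if "no_A2_contact_on_cubic M p"
  proof
    show "directions (\<lambda>v. \<exists>k. A_asymptotic k M p v) \<subseteq> directions (sing_asymptotic M p u)"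
      unfolding directions_def using forward by blast
    show "directions (sing_asymptotic M p u) \<subseteq> directions (\<lambda>v. \<exists>k. A_asymptotic k M p v)"
    proof
      fix l assume "l \<in> directions (sing_asymptotic M p u)"
      then obtain v where v: "l = span {v}" "sing_asymptotic M p u v" unfolding directions_def by blast
      then have vT: "v \<in> T" "v \<noteq> 0" by (auto simp: sing_asymptotic_def)
      \<comment> \<open>Only unit vectors are candidates for \<open>A\<^sub>k\<close>-asymptotic directions, so the representative is normalized.\<close>
      let ?v = "(1 / norm v) *\<^sub>R v"
      have "?v \<in> T" using vT subspace_T by (simp add: subspace_scale)
      then have unit: "unit_tangent M p ?v" using vT by (simp add: unit_tangent_def)
      have "sing_asymptotic M p u ?v"
        using v(2) vT \<open>?v \<in> T\<close> unfolding sing_asymptotic_iff[OF onb dimP u] by (auto simp: II_scale)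
      then have "\<exists>k. A_asymptotic k M p ?v" using iff[OF that unit] by blast
      moreover have "span {?v} = l"
        using span_image_scale[of "{v}" "\<lambda>_. 1 / norm v"] vT(2) v(1) by simp
      ultimately show "l \<in> directions (\<lambda>v. \<exists>k. A_asymptotic k M p v)"
        unfolding directions_def by blast
    qed
  qed
  show ?thesis
    using trichotomy forward iff dirs by (auto simp: hyperbolic_point_def parabolic_point_def)
qed

end
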